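(* Let $d\ge2$ and $\lambda\in i\mathbb R_{\ge0}\cup(0,\tfrac{d-1}{2})$, and let $F(z)={}_2F_1\big(\tfrac{d-1}{2}+\lambda,\tfrac{d-1}{2}-\lambda;\tfrac d2;z\big)$. The jump function $s\mapsto F(s-i0)-F(s+i0)$ vanishes identically on $(1,\infty)$ (equivalently, for $x\in\mathrm{dS}^d$ the function $D^+_{\lambda,x}-D^-_{\lambda,x}$ vanishes on $\mathrm{dS}^d\setminus\partial I(x)$, i.e. the distribution $D^+_{\lambda,x}-D^-_{\lambda,x}$ is supported in $\partial I(x)$) if and only if $d\ge4$ is even and $\lambda\in\{\tfrac{1+2k}{2}: k=0,1,\dots,\tfrac d2-2\}$.
   Context: ${}_2F_1(\alpha,\beta;\gamma;z)=\sum_{k\ge0}\frac{(\alpha)_k(\beta)_k}{(\gamma)_kk!}z^k$, extended holomorphically to $\mathbb C\setminus[1,\infty)$; for $s>1$, $F(s\pm i0)=\lim_{\varepsilon\downarrow0}F(s\pm i\varepsilon)$. On $\mathbb R^{1+d}$, $\beta(x,y)=x_0y_0-x_1y_1-\dots-x_dy_d$, $\mathrm{dS}^d=\{x:\beta(x,x)=-1\}$, $I(x)=\{y\in\mathrm{dS}^d:\beta(y-x,y-x)>0\}$, $I^\pm(x)=\{y\in I(x):\pm(y_0-x_0)>0\}$. For $y\in\mathrm{dS}^d\setminus\partial I(x)$: $D^\pm_{\lambda,x}(y)=F(\frac{1-\beta(x,y)}2)$ if $y\notin\overline{I(x)}$; $D^\pm_{\lambda,x}(y)=F(\frac{1-\beta(x,y)}2\mp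 i0)$ if $y\in I^+(x)$; $D^\pm_{\lambda,x}(y)=F(\frac{1-\beta(x,y)}2\pm i0)$ if $y\in I^-(x)$. *)

theory Defs
  imports "HOL-Complex_Analysis.Complex_Analysis"
begin

definition cut_plane :: "complex set" where
  "cut_plane = - {z. Im z = 0 \<and> 1 \<le> Re z}"

definition hyp2f1_series :: "complex \<Rightarrow> complex \<Rightarrow> complex \<Rightarrow> complex \<Rightarrow> complex" where
  "hyp2f1_series a b c z =
     (\<Sum>k. (pochhammer a k * pochhammer b k) / (pochhammer c k * fact k) * z ^ k)"

text \<open>The holomorphic extension of 2F1 to the cut plane (unique by the identity theorem,
  since the cut plane is connected).\<close>
definition hyp2f1 :: "complex \<Rightarrow> complex \<Rightarrow> complex \<Rightarrow> complex \<Rightarrow> complex" where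
  "hyp2f1 a b c = (SOME f. f holomorphic_on cut_plane \<and>
                      (\<forall>z. norm z < 1 \<longrightarrow> f z = hyp2f1_series a b c z))"

definition bv_plus :: "(complex \<Rightarrow> complex) \<Rightarrow> real \<Rightarrow> complex" where
  "bv_plus F s = Lim (at_right (0::real)) (\<lambda>e. F (complex_of_real s + \<i> * complex_of_real e))"

definition bv_minus :: "(complex \<Rightarrow> complex) \<Rightarrow> real \<Rightarrow> complex" where
  "bv_minus F s = Lim (at_right (0::real)) (\<lambda>e. F (complex_of_real s - \<i> * complex_of_real e))"

end

theory Submission
  imports Defs
begin

text \<open>
  Here \<open>a + b + 1 = 2c\<close> with \<open>c = d/2\<close>, so the hypergeometric equation is invariant under
  \<open>z \<mapsto> 1 - z\<close>. Near \<open>z = 1\<close> the function \<open>F(1 - z)\<close> is thus a regular nonvanishing solution,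
  and reduction of order (the Wronskian is \<open>\<kappa> (z(1 - z))\<^sup>-\<^sup>c\<close>) gives, with \<open>u = 1 - z\<close>,
  \<open>F(1 - u) = F(u) (C - \<kappa> (u\<^sup>1\<^sup>-\<^sup>c \<Psi>(u) - l log u))\<close>, \<open>\<Psi>\<close> holomorphic and \<open>l = 0\<close> for odd \<open>d\<close>.
  The jump can be read off: it vanishes only if \<open>\<kappa> = 0\<close> (\<open>d\<close> odd) or \<open>\<kappa> l = 0\<close> (\<open>d\<close> even).
  Then \<open>F\<close>, respectively \<open>(1 - z)\<^sup>c\<^sup>-\<^sup>1 F\<close>, extends holomorphically across \<open>z = 1\<close>, so its Taylor series
  has radius of convergence greater than \<open>1\<close>. A hypergeometric series with this property
  terminates. For \<open>F\<close> this is impossible; for \<open>(1 - z)\<^sup>c\<^sup>-\<^sup>1 F\<close>, which by Euler's transformation has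
  the parameters \<open>c - a = 1/2 - \<lambda>\<close> and \<open>c - b = 1/2 + \<lambda>\<close>, it means \<open>\<lambda> = k + 1/2\<close>. Conversely, for such
  \<open>\<lambda>\<close> the function \<open>F\<close> is rational with its only pole at \<open>1\<close>.
\<close>

subsection \<open>Hypergeometric power series\<close>

lemma tendsto_inverse_of_nat_add:
  fixes q :: complex
  shows "(\<lambda>n. 1 / (of_nat n + q)) \<longlonglongrightarrow> 0"
proof -
  have "filterlim (\<lambda>n. of_nat n + q) at_infinity sequentially"
    by (rule tendsto_add_filterlim_at_infinity'[OF tendsto_of_nat tendsto_const])
  then show ?thesis
    by (intro tendsto_divide_0[OF tendsto_const])
qed

lemma tendsto_of_nat_add_ratio:
  fixes p q :: complex
  shows "(\<lambda>n. (of_nat n + p) / (of_nat n + q)) \<longlonglongrightarrow> 1"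
proof -
  have "(\<lambda>n. 1 + (p - q) * (1 / (of_nat n + q))) \<longlonglongrightarrow> 1 + (p - q) * 0"
    by (intro tendsto_intros tendsto_inverse_of_nat_add)
  moreover have "eventually (\<lambda>n. of_nat n + q \<noteq> 0) sequentially"
  proof -
    have "eventually (\<lambda>n. real n > norm q) sequentially"
      using filterlim_real_sequentially by (simp add: filterlim_at_top_dense)
    then show ?thesis
      by eventually_elim (metis add.inverse_unique add.commute norm_minus_cancel norm_of_nat less_irrefl)
  qed
  then have "eventually (\<lambda>n. 1 + (p - q) * (1 / (of_nat n + q)) = (of_nat n + p) / (of_nat n + q)) sequentially"
    by eventually_elim (simp add: divide_simps)
  ultimately show ?thesis
    by (simp add: tendsto_cong)
qed

section \<open>The hypergeometric operator on functions and on formal power series\<close>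

definition hyp_op :: "complex \<Rightarrow> complex \<Rightarrow> complex \<Rightarrow> (complex \<Rightarrow> complex) \<Rightarrow> complex \<Rightarrow> complex" where
  "hyp_op a b c f z =
     z * (1 - z) * deriv (deriv f) z + (c - (a + b + 1) * z) * deriv f z - a * b * f z"

definition fps_hyp_op :: "complex \<Rightarrow> complex \<Rightarrow> complex \<Rightarrow> complex fps \<Rightarrow> complex fps" where
  "fps_hyp_op a b c Y =
     fps_X * (1 - fps_X) * fps_deriv (fps_deriv Y) +
     (fps_const c - fps_const (a + b + 1) * fps_X) * fps_deriv Y - fps_const (a * b) * Y"

lemma has_fps_expansion_hyp_op:
  assumes "f has_fps_expansion Y"
  shows "hyp_op a b c f has_fps_expansion fps_hyp_op a b c Y"
  unfolding hyp_op_def[abs_def] fps_hyp_op_def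
  by (intro fps_expansion_intros assms)

lemma holomorphic_on_hyp_op:
  assumes "f holomorphic_on S" "open S"
  shows "hyp_op a b c f holomorphic_on S"
  unfolding hyp_op_def[abs_def] by (intro holomorphic_intros assms)

text \<open>Comparing coefficients turns the second order equation into a two-term recurrence, from
  which uniqueness and the radius of convergence are read off.\<close>

lemma fps_nth_hyp_op:
  "fps_nth (fps_hyp_op a b c Y) n =
     (of_nat n + 1) * (of_nat n + c) * fps_nth Y (Suc n) - (of_nat n + a) * (of_nat n + b) * fps_nth Y n"
proof -
  have eq: "fps_hyp_op a b c Y =
     fps_X * fps_deriv (fps_deriv Y) - fps_X * (fps_X * fps_deriv (fps_deriv Y)) +
     fps_const c * fps_deriv Y - fps_const (a + b + 1) * (fps_X * fps_deriv Y) - fps_const (a * b) * Y"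
    by (simp add: fps_hyp_op_def algebra_simps)
  show ?thesis
    unfolding eq
    \<comment> \<open>The term with two factors \<open>fps_X\<close> looks two places back, so the
      indices 0 and 1 are separate cases.\<close>
    by (cases n rule: nat.exhaust; cases "n - 1") (simp_all add: fps_X_mult_nth algebra_simps)
qed

lemma fps_hyp_op_eq_0_iff:
  "fps_hyp_op a b c Y = 0 \<longleftrightarrow>
     (\<forall>n. (of_nat n + 1) * (of_nat n + c) * fps_nth Y (Suc n) = (of_nat n + a) * (of_nat n + b) * fps_nth Y n)"
  by (simp add: fps_eq_iff fps_nth_hyp_op)

lemma of_nat_add_neq_0:
  assumes "c \<notin> \<int>\<^sub>\<le>\<^sub>0"
  shows "of_nat n + (c::complex) \<noteq> 0"
  using assms by (metis add.commute add_eq_0_iff minus_of_nat_in_nonpos_Ints)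

definition fps_hyp :: "complex \<Rightarrow> complex \<Rightarrow> complex \<Rightarrow> complex fps" where
  "fps_hyp a b c = Abs_fps (\<lambda>k. (pochhammer a k * pochhammer b k) / (pochhammer c k * fact k))"

lemma fps_hyp_op_fps_hyp:
  assumes "c \<notin> \<int>\<^sub>\<le>\<^sub>0"
  shows "fps_hyp_op a b c (fps_hyp a b c) = 0"
  unfolding fps_hyp_op_eq_0_iff
proof
  fix n
  have "pochhammer c n \<noteq> 0"
    using assms of_nat_add_neq_0 by (auto simp: pochhammer_eq_0_iff)
  moreover have "of_nat n + c \<noteq> 0" "c + of_nat n \<noteq> 0"
    using of_nat_add_neq_0[OF assms, of n] by (auto simp: add.commute)
  moreover have "(1 + of_nat n :: complex) \<noteq> 0"
    by (metis of_nat_Suc of_nat_eq_0_iff nat.distinct(1))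
  ultimately show "(of_nat n + 1) * (of_nat n + c) * fps_nth (fps_hyp a b c) (Suc n)
      = (of_nat n + a) * (of_nat n + b) * fps_nth (fps_hyp a b c) n"
    by (simp add: fps_hyp_def pochhammer_Suc divide_simps) (simp add: algebra_simps)
qed

text \<open>The factor (n + 1)(n + c) in the recurrence never vanishes, so each coefficient
  determines the next.\<close>

lemma fps_hyp_op_unique:
  assumes "c \<notin> \<int>\<^sub>\<le>\<^sub>0" "fps_hyp_op a b c Y = 0" "fps_nth Y 0 = 1"
  shows "Y = fps_hyp a b c"
proof (rule fps_ext)
  fix n
  show "fps_nth Y n = fps_nth (fps_hyp a b c) n"
  proof (induction n)
    case 0
    then show ?case using assms by (simp add: fps_hyp_def)
  next
    case (Suc n)
    have "(of_nat n + 1) * (of_nat n + c) * fps_nth Y (Suc n)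
        = (of_nat n + 1) * (of_nat n + c) * fps_nth (fps_hyp a b c) (Suc n)"
      using assms(2) fps_hyp_op_fps_hyp[OF assms(1), of a b] Suc
      unfolding fps_hyp_op_eq_0_iff by simp
    moreover have "(of_nat n + 1 :: complex) \<noteq> 0"
      by (metis of_nat_Suc of_nat_eq_0_iff nat.distinct(1) add.commute)
    ultimately show ?case
      using of_nat_add_neq_0[OF assms(1), of n] by simp
  qed
qed

text \<open>No coefficient vanishes and their ratios tend to 1. Read contrapositively, a larger
  radius forces \<open>a\<close> or \<open>b\<close> to be a nonpositive integer, so that the series
  terminates.\<close>

lemma fps_conv_radius_hyp:
  assumes "a \<notin> \<int>\<^sub>\<le>\<^sub>0" "b \<notin> \<int>\<^sub>\<le>\<^sub>0" "c \<notin> \<int>\<^sub>\<le>\<^sub>0"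
  shows "fps_conv_radius (fps_hyp a b c) = 1"
  unfolding fps_conv_radius_def
proof (rule conv_radius_ratio_limit_nonzero[where c = 1])
  let ?f = "fps_nth (fps_hyp a b c)"
  have nz: "?f n \<noteq> 0" for n
    using assms by (auto simp: fps_hyp_def pochhammer_eq_0_iff)
  have "norm (?f n) / norm (?f (Suc n)) =
      norm ((of_nat n + 1) / (of_nat n + a) * ((of_nat n + c) / (of_nat n + b)))" for n
  proof -
    have "(of_nat n + 1) * (of_nat n + c) * ?f (Suc n) = (of_nat n + a) * (of_nat n + b) * ?f n"
      using fps_hyp_op_fps_hyp[OF assms(3), of a b] by (simp add: fps_hyp_op_eq_0_iff)
    then have "?f n / ?f (Suc n) = (of_nat n + 1) / (of_nat n + a) * ((of_nat n + c) / (of_nat n + b))"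
      using of_nat_add_neq_0[OF assms(1), of n] of_nat_add_neq_0[OF assms(2), of n] nz[of n] nz[of "Suc n"]
      by (simp add: divide_simps)
    then show ?thesis
      by (metis norm_divide)
  qed
  moreover have "(\<lambda>n. norm ((of_nat n + 1) / (of_nat n + a) * ((of_nat n + c) / (of_nat n + b)))) \<longlonglongrightarrow> norm (1 * 1 :: complex)"
    by (intro tendsto_intros tendsto_of_nat_add_ratio)
  ultimately show "(\<lambda>n. norm (?f n) / norm (?f (Suc n))) \<longlonglongrightarrow> 1"
    by simp
qed auto

text \<open>Euler's transformation: both sides solve the hypergeometric equation with parameters
  \<open>c - a\<close>, \<open>c - b\<close>, \<open>c\<close>.\<close>
lemma fps_hyp_euler:
  assumes "c \<notin> \<int>\<^sub>\<le>\<^sub>0" "a + b - c = of_nat m"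
  shows "(1 - fps_X) ^ m * fps_hyp a b c = fps_hyp (c - a) (c - b) c"
proof (rule fps_hyp_op_unique)
  define Y where "Y = fps_hyp a b c"
  define U where "U = (1 - fps_X :: complex fps)"
  define V where "V = U ^ m"
  have dU: "fps_deriv U = -1" by (simp add: U_def)
  \<comment> \<open>This relation and its derivative replace the power \<open>m\<close> by a mere
    constant, which \<open>m\<close> below identifies with a + b - c. Only polynomial identities
    remain.\<close>
  have 1: "U * fps_deriv V = - of_nat m * V"
    unfolding V_def fps_deriv_power' dU by (cases m) simp_all
  have "fps_deriv (U * fps_deriv V) = - of_nat m * fps_deriv V"
    unfolding 1 by simp
  then have 2: "U * fps_deriv (fps_deriv V) = (1 - of_nat m) * fps_deriv V"
    by (simp add: dU algebra_simps)
  have X: "fps_X = 1 - U" by (simp add: U_def)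
  have op: "fps_X * U * fps_deriv (fps_deriv Y) +
     (fps_const c - fps_const (a + b + 1) * fps_X) * fps_deriv Y - fps_const (a * b) * Y = 0"
    using fps_hyp_op_fps_hyp[OF assms(1), of a b] by (simp add: Y_def fps_hyp_op_def U_def)
  have m: "of_nat m = fps_const a + fps_const b - fps_const c"
    using assms(2) by (metis fps_const_add fps_const_sub fps_of_nat)
  \<comment> \<open>The extra factor \<open>U\<close> makes the products of \<open>U\<close> with
    the derivatives of \<open>V\<close> appear, so that these derivatives can be eliminated. It is
    cancelled at the end, formal power series over a field having no zero divisors.\<close>
  have "U * fps_hyp_op (c - a) (c - b) c (V * Y) = 
     U * V * (fps_X * U * fps_deriv (fps_deriv Y) +
     (fps_const c - fps_const (a + b + 1) * fps_X) * fps_deriv Y - fps_const (a * b) * Y)"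
  proof -
    define A B C where "A = fps_const a" and "B = fps_const b" and "C = fps_const c"
    define V1 V2 Y1 Y2 where "V1 = fps_deriv V" "V2 = fps_deriv V1" "Y1 = fps_deriv Y" "Y2 = fps_deriv Y1"
    have c: "fps_const (a * b) = A * B" "fps_const (a + b + 1) = A + B + 1"
       "fps_const ((c - a) * (c - b)) = (C - A) * (C - B)"
       "fps_const (c - a + (c - b) + 1) = 2 * C - A - B + 1"
      by (simp_all add: A_def B_def C_def fps_const_add[symmetric] fps_const_sub[symmetric] fps_const_mult[symmetric]
           del: fps_const_add fps_const_sub fps_const_mult)
    have "U * V1 = - (A + B - C) * V" "U * V2 = (1 - (A + B - C)) * V1"
      using 1 2 m by (simp_all add: V1_V2_Y1_Y2_def A_def B_def C_def)
    moreover have "U * fps_hyp_op (c - a) (c - b) c (V * Y) =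
        U * (fps_X * (1 - fps_X) * (V2 * Y + 2 * V1 * Y1 + V * Y2) +
     (C - (2 * C - A - B + 1) * fps_X) * (V1 * Y + V * Y1) - (C - A) * (C - B) * (V * Y))"
      unfolding fps_hyp_op_def c V1_V2_Y1_Y2_def fps_deriv_mult fps_deriv_add C_def[symmetric]
      by (simp add: algebra_simps)
    ultimately show ?thesis
      unfolding c V1_V2_Y1_Y2_def(3,4)[symmetric] C_def[symmetric] X by algebra
  qed
  also have "\<dots> = 0" unfolding op by simp
  finally have "U = 0 \<or> fps_hyp_op (c - a) (c - b) c (V * Y) = 0" by simp
  moreover have "U \<noteq> 0"
    using dU by force
  ultimately show "fps_hyp_op (c - a) (c - b) c ((1 - fps_X) ^ m * fps_hyp a b c) = 0"
    by (simp add: V_def Y_def U_def)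
qed (use assms in \<open>auto simp: fps_hyp_def fps_power_zeroth\<close>)

subsection \<open>Continuation to the cut plane\<close>

text \<open>These are the coefficients of the solution g with g(0) = 1 of the Heun-type equation w(1
  - w^2) g'' + (c + pw + qw^2) g' + (r + sw) g = 0. The coefficient of w^(n+1) in the equation gives
  the recurrence, the constant coefficient the value at 1.\<close>

fun ode_coeff :: "complex \<Rightarrow> complex \<Rightarrow> complex \<Rightarrow> complex \<Rightarrow> complex \<Rightarrow> nat \<Rightarrow> complex" where
  "ode_coeff c p q r s 0 = 1"
| "ode_coeff c p q r s (Suc 0) = - r / c"
| "ode_coeff c p q r s (Suc (Suc n)) =
     ((of_nat n * (of_nat n - 1 - q) - s) * ode_coeff c p q r s n
        - (p * (of_nat n + 1) + r) * ode_coeff c p q r s (Suc n))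
     / ((of_nat n + 2) * (of_nat n + (c + 1)))"

text \<open>The maximum of two consecutive norms eventually grows by at most a factor q per step,
  for any q > 1. This allows comparison with a geometric series.\<close>

lemma summable_two_term_recurrence:
  fixes f :: "nat \<Rightarrow> complex"
  assumes "A \<longlonglongrightarrow> 0" "B \<longlonglongrightarrow> 1" "norm z < 1"
    and rec: "\<And>n. norm (f (n + 2)) \<le> A n * norm (f (n + 1)) + B n * norm (f n)"
    and AB: "\<And>n. A n \<ge> 0" "\<And>n. B n \<ge> (0::real)"
  shows "summable (\<lambda>n. f n * z ^ n)"
proof (cases "z = 0")
  case False
  \<comment> \<open>The midpoint of 1 and 1/|z|, so that both q > 1 and q|z| < 1.\<close>
  define q where "q = (1 + 1 / norm z) / 2"
  have nz: "norm z > 0" using False by simp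
  have "1 / norm z > 1" using nz assms(3) by simp
  then have q: "q > 1" "q > 0" by (simp_all add: q_def)
  have "q * norm z = (norm z + 1) / 2" using nz by (simp add: q_def field_simps)
  with assms(3) have q': "q * norm z < 1" by simp
  have "(\<lambda>n. A n + B n) \<longlonglongrightarrow> 0 + 1"
    by (intro tendsto_intros assms)
  then have "eventually (\<lambda>n. A n + B n < q) sequentially"
    using q by (intro order_tendstoD) auto
  then obtain N where N: "\<And>n. n \<ge> N \<Longrightarrow> A n + B n < q"
    by (auto simp: eventually_sequentially)
  define M where "M n = max (norm (f n)) (norm (f (n + 1)))" for n
  have M_Suc: "M (Suc n) \<le> q * M n" if "n \<ge> N" for n
  proof -
    have M0: "0 \<le> M n" by (simp add: M_def le_max_iff_disj)
    have "norm (f (n + 2)) \<le> A n * M n + B n * M n"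
      using rec[of n] AB[of n] mult_left_mono[of "norm (f (n+1))" "M n" "A n"]
        mult_left_mono[of "norm (f n)" "M n" "B n"]
      by (fastforce simp: M_def)
    also have "\<dots> \<le> q * M n"
      using mult_right_mono[OF less_imp_le[OF N[OF that]] M0] by (simp add: algebra_simps)
    finally have "norm (f (n + 2)) \<le> q * M n" .
    moreover have "norm (f (n + 1)) \<le> q * M n"
      using q M0 mult_right_mono[of 1 q "M n"] by (simp add: M_def)
    ultimately show ?thesis by (simp add: M_def)
  qed
  have bound: "M (N + k) \<le> M N * q ^ k" for k
  proof (induction k)
    case (Suc k)
    have "M (N + Suc k) \<le> q * M (N + k)" using M_Suc[of "N + k"] by simp
    also have "\<dots> \<le> q * (M N * q ^ k)" using Suc q by (intro mult_left_mono) auto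
    finally show ?case by (simp add: mult_ac)
  qed simp
  have "summable (\<lambda>k. f (k + N) * z ^ (k + N))"
  proof (rule summable_comparison_test)
    show "summable (\<lambda>k. M N * norm z ^ N * (q * norm z) ^ k)"
      using q q' nz by (intro summable_mult summable_geometric) auto
    have "norm (f (k + N) * z ^ (k + N)) \<le> M N * norm z ^ N * (q * norm z) ^ k" for k
    proof -
      have "norm (f (k + N)) \<le> M N * q ^ k"
        using bound[of k] by (simp add: M_def add.commute)
      then have "norm (f (k + N)) * norm z ^ (k + N) \<le> M N * q ^ k * norm z ^ (k + N)"
        by (intro mult_right_mono) auto
      then show ?thesis by (simp add: norm_mult norm_power power_add power_mult_distrib mult_ac)
    qed
    then show "\<exists>N'. \<forall>k\<ge>N'. norm (f (k + N) * z ^ (k + N)) \<le> M N * norm z ^ N * (q * norm z) ^ k"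
      by blast
  qed
  then show ?thesis
    by (subst (asm) summable_iff_shift)
next
  case True
  then show ?thesis
    using summable_0_powser[of f] by simp
qed

text \<open>The recurrence tends to f(n+2) = f(n), in accordance with the singular points 1 and -1
  on the unit circle.\<close>

lemma fps_conv_radius_ode_coeff:
  assumes "c \<notin> \<int>\<^sub>\<le>\<^sub>0"
  shows "fps_conv_radius (Abs_fps (ode_coeff c p q r s)) \<ge> 1"
  unfolding fps_conv_radius_def
proof (rule conv_radius_geI_ex')
  let ?f = "ode_coeff c p q r s"
  \<comment> \<open>The factors of f(n+1) and f(n), up to sign, split into quotients whose limits
    are known.\<close>
  let ?A' = "\<lambda>n. (of_nat n + 1) / (of_nat n + 2) * (p * (1 / (of_nat n + (c + 1)))) + r * (1 / (of_nat n + 2)) * (1 / (of_nat n + (c + 1)))"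
  let ?B' = "\<lambda>n. (of_nat n + 0) / (of_nat n + 2) * ((of_nat n + (- 1 - q)) / (of_nat n + (c + 1))) - s * (1 / (of_nat n + 2)) * (1 / (of_nat n + (c + 1)))"
  fix R :: real
  assume R: "0 < R" "ereal R < 1"
  have A: "(\<lambda>n. norm (?A' n)) \<longlonglongrightarrow> norm (1 * (p * 0) + r * 0 * 0)"
    by (intro tendsto_intros tendsto_of_nat_add_ratio tendsto_inverse_of_nat_add)
  have B: "(\<lambda>n. norm (?B' n)) \<longlonglongrightarrow> norm (1 * 1 - s * 0 * 0)"
    by (intro tendsto_intros tendsto_of_nat_add_ratio tendsto_inverse_of_nat_add)
  show "summable (\<lambda>n. fps_nth (Abs_fps ?f) n * complex_of_real R ^ n)"
    unfolding fps_nth_Abs_fps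
  proof (rule summable_two_term_recurrence)
    show "(\<lambda>n. norm (?A' n)) \<longlonglongrightarrow> 0" using A by simp
    show "(\<lambda>n. norm (?B' n)) \<longlonglongrightarrow> 1" using B by simp
    show "norm (complex_of_real R) < 1" using R by (simp add: one_ereal_def)
    fix n
    have 1: "(of_nat n + 2 :: complex) \<noteq> 0" 
      by (metis of_nat_add of_nat_numeral of_nat_eq_0_iff add_is_0 zero_neq_numeral)
    have 2: "of_nat n + (c + 1) \<noteq> 0"
      using of_nat_add_neq_0[OF assms, of "Suc n"] by (simp add: add_ac)
    have "((m * (m - 1 - q) - s) * f0 - (p * (m + 1) + r) * f1) / (N * M) =
        ((m + 0) / N * ((m + (- 1 - q)) / M) - s * (1 / N) * (1 / M)) * f0
        - ((m + 1) / N * (p * (1 / M)) + r * (1 / N) * (1 / M)) * f1"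
      if "N \<noteq> 0" "M \<noteq> 0" for N M m f0 f1 :: complex
      using that by (simp add: field_simps)
    from this[OF 1 2] have "?f (n + 2) = ?B' n * ?f n - ?A' n * ?f (n + 1)"
      by (simp only: add_2_eq_Suc' ode_coeff.simps Suc_eq_plus1[symmetric])
    then show "norm (?f (n + 2)) \<le> norm (?A' n) * norm (?f (n + 1)) + norm (?B' n) * norm (?f n)"
      using norm_triangle_ineq4[of "?B' n * ?f n" "?A' n * ?f (n + 1)"]
      by (simp only: norm_mult add.commute)
  qed auto
qed

lemma ode_coeff_ode:
  fixes p q r s :: complex
  assumes "c \<notin> \<int>\<^sub>\<le>\<^sub>0"
  defines "g \<equiv> Abs_fps (ode_coeff c p q r s)"
  shows "fps_X * (1 - fps_X ^ 2) * fps_deriv (fps_deriv g) +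
     (fps_const c + fps_const p * fps_X + fps_const q * fps_X ^ 2) * fps_deriv g
     + (fps_const r + fps_const s * fps_X) * g = 0" (is "?L = 0")
proof (rule fps_ext)
  fix n
  have eq: "?L = fps_X * fps_deriv (fps_deriv g) - fps_X * (fps_X * (fps_X * fps_deriv (fps_deriv g))) +
     fps_const c * fps_deriv g + fps_const p * (fps_X * fps_deriv g) + fps_const q * (fps_X * (fps_X * fps_deriv g))
     + fps_const r * g + fps_const s * (fps_X * g)"
    by (simp add: algebra_simps power2_eq_square)
  have c0: "c \<noteq> 0" using assms by auto
  consider "n = 0" | m where "n = Suc m" by (cases n) auto
  then show "fps_nth ?L n = fps_nth 0 n"
  proof cases
    case 1
    then show ?thesis unfolding eq by (simp add: g_def c0)
  next
    case (2 m)
    have nz: "(of_nat m + 2 :: complex) \<noteq> 0" 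
      by (metis of_nat_add of_nat_numeral of_nat_eq_0_iff add_is_0 zero_neq_numeral)
    have nz2: "of_nat m + (c + 1) \<noteq> 0"
      using of_nat_add_neq_0[OF assms(1), of "Suc m"] by (simp add: add_ac)
    let ?f = "ode_coeff c p q r s"
    have rec: "(of_nat m + 2) * (of_nat m + (c + 1)) * ?f (Suc (Suc m)) =
      (of_nat m * (of_nat m - 1 - q) - s) * ?f m - (p * (of_nat m + 1) + r) * ?f (Suc m)"
      using nz nz2 by simp
    have "fps_nth ?L n = (of_nat m + 2) * (of_nat m + (c + 1)) * ?f (Suc (Suc m)) -
      ((of_nat m * (of_nat m - 1 - q) - s) * ?f m - (p * (of_nat m + 1) + r) * ?f (Suc m))"
      unfolding eq 2
      by (cases m; cases "m - 1") (simp_all add: fps_X_mult_nth g_def algebra_simps del: ode_coeff.simps)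
    then show ?thesis using rec by simp
  qed
qed

section \<open>The cut plane and the characterisation of \<open>hyp2f1\<close>\<close>

lemma cut_plane_iff: "z \<in> cut_plane \<longleftrightarrow> 1 - z \<notin> \<real>\<^sub>\<le>\<^sub>0"
  by (auto simp: cut_plane_def complex_nonpos_Reals_iff)

lemma open_cut_plane: "open cut_plane"
proof -
  have "cut_plane = (\<lambda>z. 1 - z) -` (- \<real>\<^sub>\<le>\<^sub>0)"
    by (auto simp: cut_plane_iff)
  moreover have "open ((\<lambda>z::complex. 1 - z) -` (- \<real>\<^sub>\<le>\<^sub>0))"
    by (intro open_vimage continuous_intros open_Compl closed_nonpos_Reals_complex)
  ultimately show ?thesis by simp
qed

lemma connected_cut_plane: "connected cut_plane"
proof (rule starlike_imp_connected, unfold starlike_def, intro bexI ballI subsetI)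
  fix x z assume "x \<in> cut_plane" and "z \<in> closed_segment 0 x"
  then obtain t where t: "0 \<le> t" "t \<le> 1" "z = of_real t * x"
    by (auto simp: in_segment scaleR_conv_of_real)
  show "z \<in> cut_plane"
  proof (rule ccontr)
    assume "z \<notin> cut_plane"
    then have z: "t * Im x = 0" "1 \<le> t * Re x"
      by (auto simp: t cut_plane_def)
    then have "Im x = 0" by auto
    moreover have "0 < t * Re x" using z by linarith
    then have "0 \<le> Re x" using t by (simp add: zero_less_mult_iff)
    then have "t * Re x \<le> 1 * Re x" using t by (intro mult_right_mono) auto
    then have "1 \<le> Re x" using z by simp
    ultimately show False using \<open>x \<in> cut_plane\<close> by (simp add: cut_plane_def)
  qed
qed (auto simp: cut_plane_def)

lemma unit_ball_subset_cut_plane: "ball 0 1 \<subseteq> cut_plane"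
proof
  fix z :: complex assume "z \<in> ball 0 1"
  then have "Re z < 1" using abs_Re_le_cmod[of z] by simp
  then show "z \<in> cut_plane" by (auto simp: cut_plane_def)
qed

lemma zero_in_cut_plane: "0 \<in> cut_plane"
  by (simp add: cut_plane_def)

text \<open>Being holomorphic on the unit disc, \<open>f\<close> is the sum of its series there, so
  it is a witness for the choice in \<open>hyp2f1\<close>. The chosen function then agrees with
  \<open>f\<close> by the identity theorem.\<close>

lemma hyp2f1_eqI:
  assumes "f holomorphic_on cut_plane" "f has_fps_expansion fps_hyp a b c" "z \<in> cut_plane"
  shows "hyp2f1 a b c z = f z"
proof -
  let ?P = "\<lambda>f. f holomorphic_on cut_plane \<and> (\<forall>z. norm z < 1 \<longrightarrow> f z = hyp2f1_series a b c z)"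
  have "f w = hyp2f1_series a b c w" if "norm w < 1" for w
  proof -
    have "(\<lambda>n. fps_nth (fps_hyp a b c) n * w ^ n) sums f w"
      using that assms(1) unit_ball_subset_cut_plane
      by (intro has_fps_expansion_imp_sums_complex[OF assms(2), of 1])
        (auto simp: one_ereal_def intro: holomorphic_on_subset)
    then show ?thesis
      by (simp add: hyp2f1_series_def fps_hyp_def sums_iff)
  qed
  then have f: "?P f" using assms(1) by blast
  have h: "?P (hyp2f1 a b c)"
    unfolding hyp2f1_def by (rule someI[of ?P, OF f])
  show ?thesis
    by (rule analytic_continuation_open[of "ball 0 1" cut_plane])
      (use f h assms(3) unit_ball_subset_cut_plane open_cut_plane connected_cut_plane in auto)
qed

text \<open>The left-hand side is holomorphic on the unit disc and its expansion at 0 vanishes by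
  the formal equation.\<close>

lemma ode_coeff_eval:
  fixes p q r s :: complex
  assumes "c \<notin> \<int>\<^sub>\<le>\<^sub>0" "norm w < 1"
  defines "G \<equiv> Abs_fps (ode_coeff c p q r s)"
  shows "w * (1 - w ^ 2) * eval_fps (fps_deriv (fps_deriv G)) w + (c + p * w + q * w ^ 2) * eval_fps (fps_deriv G) w
    + (r + s * w) * eval_fps G w = 0"
proof (rule has_fps_expansion_0_analytic_continuation[where A = "ball 0 1" and x = w and
    f = "\<lambda>w. w * (1 - w ^ 2) * eval_fps (fps_deriv (fps_deriv G)) w + (c + p * w + q * w ^ 2) * eval_fps (fps_deriv G) w
    + (r + s * w) * eval_fps G w"])
  have R: "fps_conv_radius G \<ge> 1"
    unfolding G_def by (rule fps_conv_radius_ode_coeff[OF assms(1)])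
  have R1: "fps_conv_radius (fps_deriv G) \<ge> 1"
    by (rule order_trans[OF R fps_conv_radius_deriv])
  have R2: "fps_conv_radius (fps_deriv (fps_deriv G)) \<ge> 1"
    by (rule order_trans[OF R1 fps_conv_radius_deriv])
  have pos: "x > 0" if "x \<ge> 1" for x :: ereal
    using that by (rule less_le_trans[rotated]) simp
  show "(\<lambda>w. w * (1 - w ^ 2) * eval_fps (fps_deriv (fps_deriv G)) w + (c + p * w + q * w ^ 2) * eval_fps (fps_deriv G) w
    + (r + s * w) * eval_fps G w) has_fps_expansion 0"
    by (rule has_fps_expansion_schematicI[OF _ ode_coeff_ode[OF assms(1), of p q r s, folded G_def]])
      (intro fps_expansion_intros eval_fps_has_fps_expansion pos R R1 R2)
  have sub: "ball 0 1 \<subseteq> eball (0::complex) x" if "x \<ge> 1" for x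
    using ball_eball_mono[of 1 x "0::complex"] that by (simp add: one_ereal_def)
  show "(\<lambda>w. w * (1 - w ^ 2) * eval_fps (fps_deriv (fps_deriv G)) w + (c + p * w + q * w ^ 2) * eval_fps (fps_deriv G) w
    + (r + s * w) * eval_fps G w) holomorphic_on ball 0 1"
    by (intro holomorphic_intros sub R R1 R2)
qed (use assms in auto)

text \<open>The conformal map of the cut plane onto the unit disc inverse to \<open>w \<mapsto> 4w/(1+w)\<^sup>2\<close> is
  \<open>w = (1 - r)/(1 + r)\<close> with \<open>r = csqrt (1 - z)\<close>. Writing the solution as
  \<open>(1 + w)\<^sup>2\<^sup>a g(w)\<close>, the equation for \<open>g\<close> has its singular points at \<open>0\<close>, \<open>1\<close>, \<open>-1\<close> (and infinity)
  with simple poles, so the power series of \<open>g\<close> converges in the whole disc.\<close>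
lemma hyp_ode_solution_on_cut_plane:
  assumes "a + b + 1 = 2 * c" "c \<notin> \<int>\<^sub>\<le>\<^sub>0"
  shows "\<exists>f. f holomorphic_on cut_plane \<and> (\<forall>z\<in>cut_plane. hyp_op a b c f z = 0) \<and> f 0 = 1"
proof -
  \<comment> \<open>The constants obtained by substituting the ansatz into the hypergeometric
    equation, with b = 2c - 1 - a; \<open>c0\<close> and \<open>c1\<close> below confirm
    them.\<close>
  define p q s t where "p = 4 - 6 * c + 4 * a" "q = c - 2 - 4 * a" "s = 2 * a * c - 4 * a * b"
    "t = - s - 2 * a * (2 * c - 1)"
  define G where "G = Abs_fps (ode_coeff c p q s t)"
  define r where "r z = csqrt (1 - z)" for z
  define w where "w z = (1 - r z) / (1 + r z)" for z
  \<comment> \<open>As 1 + w = 2/(1 + r), this is the factor (1 + w)^(2a), with its branch fixed by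
    the principal logarithm.\<close>
  define E where "E z = exp (2 * a * (Ln 2 - Ln (1 + r z)))" for z
  define g0 where "g0 = eval_fps G"
  define g1 where "g1 = eval_fps (fps_deriv G)"
  define g2 where "g2 = eval_fps (fps_deriv (fps_deriv G))"
  define f where "f z = E z * g0 (w z)" for z
  \<comment> \<open>\<open>f1\<close> and \<open>f2\<close> are the first two derivatives of
    \<open>f\<close>: here a/(r(1 + r)) is E'/E and 1/(r(1 + r)^2) is w'.\<close>
  define f1 where "f1 z = E z * (a / (r z * (1 + r z)) * g0 (w z) + 1 / (r z * (1 + r z) ^ 2) * g1 (w z))" for z
  define f2 where "f2 z = E z * 
     (((a / (r z * (1 + r z))) ^ 2 + a * (1 + 2 * r z) / (2 * r z ^ 3 * (1 + r z) ^ 2)) * g0 (w z) 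
      + (2 * (a / (r z * (1 + r z))) * (1 / (r z * (1 + r z) ^ 2)) + (1 + 3 * r z) / (2 * r z ^ 3 * (1 + r z) ^ 3)) * g1 (w z)
      + (1 / (r z * (1 + r z) ^ 2)) ^ 2 * g2 (w z))" for z
  have R: "fps_conv_radius G \<ge> 1"
    unfolding G_def by (rule fps_conv_radius_ode_coeff[OF assms(2)])
  have R1: "fps_conv_radius (fps_deriv G) \<ge> 1"
    by (rule order_trans[OF R fps_conv_radius_deriv])
  have r_pos: "Re (r z) > 0" if "z \<in> cut_plane" for z
  proof (rule ccontr)
    assume "\<not> ?thesis"
    then have "Re (r z) = 0" using csqrt_principal[of "1 - z"] by (auto simp: r_def)
    moreover have "1 - z = r z * r z"
      by (metis r_def power2_csqrt power2_eq_square)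
    ultimately show False
      using that by (simp add: cut_plane_iff complex_nonpos_Reals_iff)
  qed
  have r_nz: "r z \<noteq> 0" "1 + r z \<noteq> 0" "1 + r z \<notin> \<real>\<^sub>\<le>\<^sub>0" if "z \<in> cut_plane" for z
    using r_pos[OF that] by (auto simp: complex_eq_iff complex_nonpos_Reals_iff)
  have r_sq: "z = 1 - r z ^ 2" for z
    by (simp add: r_def)
  have dr: "(r has_field_derivative (- 1 / (2 * r z))) (at z)" if "z \<in> cut_plane" for z
    using that unfolding r_def cut_plane_iff by (auto intro!: derivative_eq_intros)
  have dw: "(w has_field_derivative (1 / (r z * (1 + r z) ^ 2))) (at z)" if "z \<in> cut_plane" for z
    unfolding w_def[abs_def] using r_nz[OF that]
    by (auto intro!: derivative_eq_intros dr[OF that] simp: field_simps power2_eq_square)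
  have dE: "(E has_field_derivative (E z * (a / (r z * (1 + r z))))) (at z)" if "z \<in> cut_plane" for z
  proof -
    have "((\<lambda>z. 2 * a * (Ln 2 - Ln (1 + r z))) has_field_derivative (a / (r z * (1 + r z)))) (at z)"
      using r_nz[OF that] by (auto intro!: derivative_eq_intros dr[OF that] simp: divide_simps)
    then show ?thesis
      unfolding E_def[abs_def] by (rule DERIV_chain2[OF DERIV_exp])
  qed
  have w: "norm (w z) < 1" if "z \<in> cut_plane" for z
  proof -
    \<comment> \<open>The real part of \<open>r z\<close> is positive, and the Cayley transform maps
      the right half-plane into the disc.\<close>
    have "norm (1 - r z) ^ 2 < norm (1 + r z) ^ 2"
      using r_pos[OF that] unfolding cmod_power2 by (simp add: power2_eq_square algebra_simps)
    then have "norm (1 - r z) < norm (1 + r z)"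
      by (rule power2_less_imp_less) auto
    then show ?thesis by (simp add: w_def norm_divide divide_simps)
  qed
  have w': "ereal (norm (w z)) < x" if "z \<in> cut_plane" "x \<ge> 1" for z x
    using w[OF that(1)] that(2) by (metis ereal_less(3) less_le_trans)
  have dg0: "((\<lambda>z. g0 (w z)) has_field_derivative (g1 (w z) * (1 / (r z * (1 + r z) ^ 2)))) (at z)" if "z \<in> cut_plane" for z
    unfolding g0_def g1_def using w'[OF that R] dw[OF that]
    by (intro DERIV_chain2[OF has_field_derivative_eval_fps])
  have dg1: "((\<lambda>z. g1 (w z)) has_field_derivative (g2 (w z) * (1 / (r z * (1 + r z) ^ 2)))) (at z)" if "z \<in> cut_plane" for z
    unfolding g2_def g1_def using w'[OF that R1] dw[OF that]
    by (intro DERIV_chain2[OF has_field_derivative_eval_fps])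
  have df: "(f has_field_derivative f1 z) (at z)" if "z \<in> cut_plane" for z
    unfolding f_def[abs_def] f1_def
    by (rule DERIV_cong[OF DERIV_mult[OF dE[OF that] dg0[OF that]]]) (simp add: algebra_simps)
  have d\<alpha>: "((\<lambda>z. a / (r z * (1 + r z))) has_field_derivative (a * (1 + 2 * r z) / (2 * r z ^ 3 * (1 + r z) ^ 2))) (at z)"
    if "z \<in> cut_plane" for z
    using r_nz[OF that]
    by (auto intro!: derivative_eq_intros dr[OF that] simp: divide_simps) (simp_all add: algebra_simps power2_eq_square power3_eq_cube)
  have d\<omega>: "((\<lambda>z. 1 / (r z * (1 + r z) ^ 2)) has_field_derivative ((1 + 3 * r z) / (2 * r z ^ 3 * (1 + r z) ^ 3))) (at z)"
    if "z \<in> cut_plane" for z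
    using r_nz[OF that]
    by (auto intro!: derivative_eq_intros dr[OF that] simp: divide_simps) (simp_all add: algebra_simps power2_eq_square power3_eq_cube)
  have df1: "(f1 has_field_derivative f2 z) (at z)" if "z \<in> cut_plane" for z
    unfolding f1_def[abs_def] f2_def
    by (rule DERIV_cong[OF DERIV_mult[OF dE[OF that] DERIV_add[OF DERIV_mult[OF d\<alpha>[OF that] dg0[OF that]] DERIV_mult[OF d\<omega>[OF that] dg1[OF that]]]]])
      (simp add: algebra_simps power2_eq_square)
  have hol: "f holomorphic_on cut_plane"
    using df open_cut_plane by (auto simp: holomorphic_on_open)
  have op: "hyp_op a b c f z = 0" if z: "z \<in> cut_plane" for z
  proof -
    have 1: "deriv f z = f1 z" using df[OF z] by (rule DERIV_imp_deriv)
    have "eventually (\<lambda>z. deriv f z = f1 z) (nhds z)"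
      using eventually_nhds_in_open[OF open_cut_plane z]
      by eventually_elim (auto intro: DERIV_imp_deriv df)
    then have "deriv (deriv f) z = deriv f1 z"
      by (rule deriv_cong_ev) simp
    then have 2: "deriv (deriv f) z = f2 z"
      using DERIV_imp_deriv[OF df1[OF z]] by simp
    define x where "x = r z"
    have x: "x \<noteq> 0" "1 + x \<noteq> 0" using r_nz[OF z] by (auto simp: x_def)
    have zx: "z = 1 - x ^ 2" using r_sq[of z] by (simp add: x_def)
    have wx: "w z = (1 - x) / (1 + x)" by (simp add: w_def x_def)
    have b: "b = 2 * c - 1 - a" using assms(1) by (simp add: algebra_simps)
    \<comment> \<open>Replacing the reciprocals by variables with the relations \<open>hij\<close>
      leaves polynomial identities, which \<open>algebra\<close> can decide.\<close>
    define h i j where "h = (1 / 2 :: complex)" and "i = 1 / x" and "j = 1 / (1 + x)"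
    have hij: "2 * h = 1" "x * i = 1" "(1 + x) * j = 1" using x by (auto simp: h_def i_def j_def)
    have divs: "a / (x * (1 + x)) = a * i * j" "1 / (x * (1 + x) ^ 2) = i * j ^ 2"
      "a * (1 + 2 * x) / (2 * x ^ 3 * (1 + x) ^ 2) = a * (1 + 2 * x) * i ^ 3 * j ^ 2 * h"
      "(1 + 3 * x) / (2 * x ^ 3 * (1 + x) ^ 3) = (1 + 3 * x) * i ^ 3 * j ^ 3 * h"
      "w z = (1 - x) * j"
      by (simp_all add: h_def i_def j_def wx power_divide)
    \<comment> \<open>After multiplication by 4, the coefficients of \<open>g0\<close>,
      \<open>g1\<close> and \<open>g2\<close> are those of the equation in w up to the common factor
      1/x; this is shown one by one in \<open>c0\<close>, \<open>c1\<close>,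
      \<open>c2\<close>.\<close>
    have c0: "4 * (z * (1 - z) * ((a * i * j) ^ 2 + a * (1 + 2 * x) * i ^ 3 * j ^ 2 * h) + c * (1 - 2 * z) * (a * i * j) - a * b)
        = i * (s + t * w z)"
      unfolding divs(5) unfolding zx b p_q_s_t_def using hij by algebra
    have c1: "4 * (z * (1 - z) * (2 * (a * i * j) * (i * j ^ 2) + (1 + 3 * x) * i ^ 3 * j ^ 3 * h) + c * (1 - 2 * z) * (i * j ^ 2))
        = i * (c + p * w z + q * w z ^ 2)"
      unfolding divs(5) unfolding zx b p_q_s_t_def using hij by algebra
    have c2: "4 * (z * (1 - z) * (i * j ^ 2) ^ 2) = i * (w z * (1 - w z ^ 2))"
      unfolding divs(5) unfolding zx using hij by algebra
    have ode: "w z * (1 - w z ^ 2) * g2 (w z) + (c + p * w z + q * w z ^ 2) * g1 (w z) + (s + t * w z) * g0 (w z) = 0"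
      using ode_coeff_eval[OF assms(2) w[OF z], of p q s t] by (simp add: g0_def g1_def g2_def G_def)
    have "hyp_op a b c f z = z * (1 - z) * f2 z + (c - 2 * c * z) * f1 z - a * b * f z"
      unfolding hyp_op_def 1 2 assms(1) ..
    also have "4 * \<dots> = E z * (
       4 * (z * (1 - z) * ((a * i * j) ^ 2 + a * (1 + 2 * x) * i ^ 3 * j ^ 2 * h) + c * (1 - 2 * z) * (a * i * j) - a * b) * g0 (w z)
       + 4 * (z * (1 - z) * (2 * (a * i * j) * (i * j ^ 2) + (1 + 3 * x) * i ^ 3 * j ^ 3 * h) + c * (1 - 2 * z) * (i * j ^ 2)) * g1 (w z)
       + 4 * (z * (1 - z) * (i * j ^ 2) ^ 2) * g2 (w z))"
      unfolding f_def f1_def f2_def x_def[symmetric] divs(1-4) power_divide by (simp add: algebra_simps)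
    also have "\<dots> = E z * i * (w z * (1 - w z ^ 2) * g2 (w z) + (c + p * w z + q * w z ^ 2) * g1 (w z) + (s + t * w z) * g0 (w z))"
      unfolding c0 c1 c2 by algebra
    finally show ?thesis unfolding ode by simp
  qed
  have "f 0 = 1"
    by (simp add: f_def E_def w_def r_def g0_def eval_fps_at_0 G_def)
  with hol op show ?thesis by blast
qed

text \<open>The solution on the cut plane has the hypergeometric expansion at 0 by uniqueness of the
  recurrence, so it is the continuation. The equation for \<open>hyp2f1\<close> itself then spreads
  from 0 by the identity theorem.\<close>

lemma hyp2f1_properties:
  assumes "a + b + 1 = 2 * c" "c \<notin> \<int>\<^sub>\<le>\<^sub>0"
  shows "hyp2f1 a b c holomorphic_on cut_plane"
    and "hyp2f1 a b c has_fps_expansion fps_hyp a b c"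
    and "\<And>z. z \<in> cut_plane \<Longrightarrow> hyp_op a b c (hyp2f1 a b c) z = 0"
    and "hyp2f1 a b c 0 = 1"
proof -
  obtain f where f: "f holomorphic_on cut_plane" "\<And>z. z \<in> cut_plane \<Longrightarrow> hyp_op a b c f z = 0" "f 0 = 1"
    using hyp_ode_solution_on_cut_plane[OF assms] by blast
  define Y where "Y = fps_expansion f 0"
  have Y: "f has_fps_expansion Y"
    unfolding Y_def using f(1) open_cut_plane zero_in_cut_plane by blast
  have "(\<lambda>_. 0) has_fps_expansion fps_hyp_op a b c Y"
  proof -
    have "eventually (\<lambda>z. hyp_op a b c f z = 0) (nhds 0)"
      using eventually_nhds_in_open[OF open_cut_plane zero_in_cut_plane]
      by eventually_elim (rule f)
    from has_fps_expansion_cong[OF this refl, of "fps_hyp_op a b c Y"] show ?thesis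
      using has_fps_expansion_hyp_op[OF Y] by blast
  qed
  then have "fps_hyp_op a b c Y = 0"
    by (rule fps_expansion_unique_complex[OF _ has_fps_expansion_0])
  moreover have "fps_nth Y 0 = 1"
    using fps_nth_fps_expansion[OF Y, of 0] f(3) by simp
  ultimately have "Y = fps_hyp a b c"
    by (intro fps_hyp_op_unique assms(2))
  with Y have exp_f: "f has_fps_expansion fps_hyp a b c" by simp
  have eq: "hyp2f1 a b c z = f z" if "z \<in> cut_plane" for z
    using hyp2f1_eqI[OF f(1) exp_f that] .
  show hol: "hyp2f1 a b c holomorphic_on cut_plane"
    using f(1) eq by (simp cong: holomorphic_cong)
  have ev: "eventually (\<lambda>z. hyp2f1 a b c z = f z) (nhds 0)"
    using eventually_nhds_in_open[OF open_cut_plane zero_in_cut_plane] by eventually_elim (rule eq)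
  show exp: "hyp2f1 a b c has_fps_expansion fps_hyp a b c"
    using exp_f has_fps_expansion_cong[OF ev refl, of "fps_hyp a b c"] by blast
  show "hyp2f1 a b c 0 = 1"
    using eq[OF zero_in_cut_plane] f(3) by simp
  show "hyp_op a b c (hyp2f1 a b c) z = 0" if "z \<in> cut_plane" for z
  proof (rule has_fps_expansion_0_analytic_continuation[OF _ _ open_cut_plane connected_cut_plane zero_in_cut_plane that])
    show "hyp_op a b c (hyp2f1 a b c) has_fps_expansion 0"
      using has_fps_expansion_hyp_op[OF exp, of a b c] by (simp add: fps_hyp_op_fps_hyp[OF assms(2)])
    show "hyp_op a b c (hyp2f1 a b c) holomorphic_on cut_plane"
      by (rule holomorphic_on_hyp_op[OF hol open_cut_plane])
  qed
qed

subsection \<open>Behaviour near the singularity at 1\<close>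

text \<open>The slit ball is star-shaped about r/2. Its connectedness makes the Wronskian constant
  and the constant of integration global.\<close>

lemma connected_slit_ball:
  assumes "0 < r"
  shows "connected (ball 0 r - \<real>\<^sub>\<le>\<^sub>0 :: complex set)"
proof (rule starlike_imp_connected, unfold starlike_def, intro bexI ballI subsetI)
  let ?p = "of_real (r / 2) :: complex"
  fix x z assume x: "x \<in> ball 0 r - \<real>\<^sub>\<le>\<^sub>0" and z: "z \<in> closed_segment ?p x"
  have "z \<in> ball 0 r"
    using x z assms closed_segment_subset[of ?p "ball 0 r" x] by (auto simp: convex_ball norm_divide)
  moreover have "z \<notin> \<real>\<^sub>\<le>\<^sub>0"
  proof
    assume zn: "z \<in> \<real>\<^sub>\<le>\<^sub>0"
    obtain t where t: "0 \<le> t" "t \<le> 1" "z = of_real (1 - t) * ?p + of_real t * x"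
      using z by (auto simp: in_segment scaleR_conv_of_real)
    have 1: "t * Im x = 0" "(1 - t) * (r / 2) + t * Re x \<le> 0"
      using zn by (auto simp: t(3) complex_nonpos_Reals_iff)
    have "t > 0" using 1(2) t assms by (cases "t = 0") auto
    then have "Im x = 0" using 1(1) by simp
    moreover have "t * Re x \<le> 0" using 1(2) t assms
      by (smt (verit) mult_nonneg_nonneg half_gt_zero)
    then have "Re x \<le> 0" using \<open>t > 0\<close> by (simp add: mult_le_0_iff)
    ultimately show False using x by (simp add: complex_nonpos_Reals_iff)
  qed
  ultimately show "z \<in> ball 0 r - \<real>\<^sub>\<le>\<^sub>0" by simp
qed (use assms in \<open>auto simp: complex_nonpos_Reals_iff\<close>)

lemma open_slit_ball: "open (ball 0 r - \<real>\<^sub>\<le>\<^sub>0 :: complex set)"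
  by (intro open_Diff open_ball closed_nonpos_Reals_complex)

text \<open>This carries the termwise integration from formal series to functions, again by the
  identity theorem; \<open>l * u ^ m\<close> is the resonant term.\<close>

lemma fps_eval_ode_zero:
  fixes Q :: "complex fps"
  assumes "\<phi> holomorphic_on ball 0 r" "\<phi> has_fps_expansion P" "ereal r \<le> fps_conv_radius Q" "r > 0"
    and "fps_const k * Q - fps_X * fps_deriv Q = P - fps_const l * fps_X ^ m" "u \<in> ball 0 r"
  shows "k * eval_fps Q u - u * eval_fps (fps_deriv Q) u = \<phi> u - l * u ^ m"
proof -
  have R1: "ereal r \<le> fps_conv_radius (fps_deriv Q)"
    by (rule order_trans[OF assms(3) fps_conv_radius_deriv])
  have pos: "x > 0" if "x \<ge> ereal r" for x :: ereal
    using that assms(4) by (metis ereal_less(2) less_le_trans)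
  have "k * eval_fps Q u - u * eval_fps (fps_deriv Q) u - (\<phi> u - l * u ^ m) = 0"
  proof (rule has_fps_expansion_0_analytic_continuation[where A = "ball 0 r" and x = u and
    f = "\<lambda>u. k * eval_fps Q u - u * eval_fps (fps_deriv Q) u - (\<phi> u - l * u ^ m)"])
    show "(\<lambda>u. k * eval_fps Q u - u * eval_fps (fps_deriv Q) u - (\<phi> u - l * u ^ m)) has_fps_expansion 0"
    proof (rule has_fps_expansion_schematicI)
      show "(\<lambda>u. k * eval_fps Q u - u * eval_fps (fps_deriv Q) u - (\<phi> u - l * u ^ m)) has_fps_expansion
        (fps_const k * Q - fps_X * fps_deriv Q - (P - fps_const l * fps_X ^ m))"
        by (intro fps_expansion_intros eval_fps_has_fps_expansion pos assms(2,3) R1)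
    qed (simp add: assms(5))
    have sub: "ball 0 r \<subseteq> eball (0::complex) x" if "x \<ge> ereal r" for x
      using ball_eball_mono[of r x "0::complex"] that by simp
    show "(\<lambda>u. k * eval_fps Q u - u * eval_fps (fps_deriv Q) u - (\<phi> u - l * u ^ m)) holomorphic_on ball 0 r"
      by (intro holomorphic_intros sub assms(1,3) R1)
  qed (use assms in auto)
  then show ?thesis by simp
qed

text \<open>Termwise integration of \<open>u\<^sup>-\<^sup>c \<phi>(u)\<close>. The coefficient of \<open>u\<^sup>c\<^sup>-\<^sup>1\<close>, present only if \<open>c\<close> is an
  integer, produces a logarithm; the division by zero in the series then contributes \<open>0\<close>.\<close>
lemma primitive_of_power_times_holomorphic:
  fixes d :: nat and \<phi> :: "complex \<Rightarrow> complex"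
  defines "c \<equiv> of_nat d / 2"
  assumes "d \<ge> 2" "\<phi> holomorphic_on ball 0 r" "r > 0"
  obtains \<Psi> l where "\<Psi> holomorphic_on ball 0 r" "c \<noteq> 1 \<Longrightarrow> \<Psi> 0 = \<phi> 0 / (c - 1)" "odd d \<Longrightarrow> l = 0"
    "\<And>u. u \<in> ball 0 r - \<real>\<^sub>\<le>\<^sub>0 \<Longrightarrow> ((\<lambda>u. exp ((1 - c) * Ln u) * \<Psi> u - l * Ln u) has_field_derivative
       - (exp (- c * Ln u) * \<phi> u)) (at u)"
proof -
  define P where "P = fps_expansion \<phi> 0"
  have P: "\<phi> has_fps_expansion P"
    unfolding P_def using assms by (intro has_fps_expansion_fps_expansion[of "ball 0 r"]) auto
  have RP: "ereal r \<le> fps_conv_radius P"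
    by (rule holomorphic_on_imp_fps_conv_radius_ge[OF P]) (use assms in simp)
  define Q where "Q = Abs_fps (\<lambda>n. fps_nth P n / (c - 1 - of_nat n))"
  \<comment> \<open>For even \<open>d\<close> this is c - 1, the one index at which the denominator
    in \<open>Q\<close> vanishes; for odd \<open>d\<close> there is none and \<open>l\<close> is
    0.\<close>
  define m where "m = (d - 2) div 2"
  define l where "l = (if even d then fps_nth P m else 0)"
  define \<Psi> where "\<Psi> = eval_fps Q"
  have cn: "c - 1 - of_nat n = of_int (int d - 2 - 2 * int n) / 2" for n
    by (simp add: c_def field_simps)
  \<comment> \<open>Twice the denominator is an integer, so a nonzero denominator has modulus at
    least 1/2. Hence \<open>Q\<close> converges wherever \<open>P\<close> does.\<close>
  have bound: "norm (1 / (c - 1 - of_nat n)) \<le> 2" for n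
  proof (cases "int d - 2 - 2 * int n = 0")
    case False
    then have "1 \<le> \<bar>real_of_int (int d - 2 - 2 * int n)\<bar>" by linarith
    then show ?thesis unfolding cn norm_divide norm_of_int by (simp add: field_simps)
  qed (simp add: cn)
  have RQ: "ereal r \<le> fps_conv_radius Q"
    unfolding fps_conv_radius_def
  proof (rule conv_radius_geI_ex')
    fix R assume "0 < R" "ereal R < ereal r"
    then have "ereal (norm (complex_of_real R)) < fps_conv_radius P"
      using RP by (metis abs_of_pos less_le_trans norm_of_real)
    from norm_summable_fps[OF this] have sm: "summable (\<lambda>n. 2 * norm (fps_nth P n * of_real R ^ n))"
      by (intro summable_mult)
    have le: "norm (fps_nth Q n * complex_of_real R ^ n) \<le> 2 * norm (fps_nth P n * of_real R ^ n)" for n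
    proof -
      have "fps_nth Q n * complex_of_real R ^ n = 1 / (c - 1 - of_nat n) * (fps_nth P n * of_real R ^ n)"
        by (simp add: Q_def)
      then show ?thesis
        using mult_right_mono[OF bound[of n], of "norm (fps_nth P n * of_real R ^ n)"] by (simp only: norm_mult) simp
    qed
    show "summable (\<lambda>n. fps_nth Q n * complex_of_real R ^ n)"
      by (rule summable_comparison_test[OF _ sm]) (use le in blast)
  qed
  have ode_fps: "fps_const (c - 1) * Q - fps_X * fps_deriv Q = P - fps_const l * fps_X ^ m"
  proof (rule fps_ext)
    fix n
    have "fps_nth (fps_const (c - 1) * Q - fps_X * fps_deriv Q) n = (c - 1 - of_nat n) * fps_nth Q n"
      by (cases n) (simp_all add: algebra_simps)
    also have "\<dots> = fps_nth P n - l * (if n = m then 1 else 0)"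
    proof (cases "int d - 2 - 2 * int n = 0")
      case True
      then have "even d" "n = m" using assms(2) by (auto simp: m_def) presburger+
      with True show ?thesis by (simp add: cn l_def)
    next
      case False
      moreover have "int d - 2 = 2 * int m" if "even d"
        using that assms(2) unfolding m_def by presburger
      ultimately have "l = 0 \<or> n \<noteq> m" by (auto simp: l_def)
      moreover have "c - 1 - of_nat n \<noteq> 0" unfolding cn using False by (metis divide_eq_0_iff of_int_eq_0_iff zero_neq_numeral)
      ultimately show ?thesis by (auto simp: Q_def)
    qed
    finally show "fps_nth (fps_const (c - 1) * Q - fps_X * fps_deriv Q) n = fps_nth (P - fps_const l * fps_X ^ m) n"
      by simp
  qed
  have ode: "(c - 1) * \<Psi> u - u * eval_fps (fps_deriv Q) u = \<phi> u - l * u ^ m" if "u \<in> ball 0 r" for u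
    unfolding \<Psi>_def using fps_eval_ode_zero[OF assms(3) P RQ assms(4) ode_fps that] .
  \<comment> \<open>For even \<open>d\<close> the exponent m - c is -1, so the resonant term is
    cancelled by the derivative of the logarithm.\<close>
  have lm: "l * u ^ m * exp (- c * Ln u) = l / u" if "u \<noteq> 0" for u
  proof (cases "even d")
    case True
    then obtain k where k: "d = 2 * Suc k"
      using assms(2) by (metis One_nat_def Suc_pred dvd_def le_antisym less_numeral_extra(3) mult_0_right not_gr_zero not_numeral_le_zero)
    have "c = of_nat (Suc k)" by (simp add: k c_def field_simps)
    then have "exp (- c * Ln u) = inverse (exp (of_nat (Suc k) * Ln u))"
      by (simp only: exp_minus mult_minus_left)
    also have "exp (of_nat (Suc k) * Ln u) = u ^ Suc k"
      by (simp only: exp_of_nat_mult exp_Ln[OF that])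
    finally show ?thesis using that by (simp add: k m_def field_simps)
  qed (simp add: l_def)
  show thesis
  proof (rule that[of \<Psi> l])
    show "\<Psi> holomorphic_on ball 0 r"
      unfolding \<Psi>_def using ball_eball_mono[OF RQ] by (intro holomorphic_intros)
    show "\<Psi> 0 = \<phi> 0 / (c - 1)" if "c \<noteq> 1"
      using ode[of 0] that assms(4) by (cases "m = 0") (auto simp: \<Psi>_def eval_fps_at_0 Q_def fps_nth_fps_expansion[OF P])
    show "l = 0" if "odd d" using that by (simp add: l_def)
    fix u :: complex assume u: "u \<in> ball 0 r - \<real>\<^sub>\<le>\<^sub>0"
    then have nz: "u \<noteq> 0" by auto
    have d\<Psi>: "(\<Psi> has_field_derivative eval_fps (fps_deriv Q) u) (at u)"
      unfolding \<Psi>_def using u by (intro has_field_derivative_eval_fps less_le_trans[OF _ RQ]) simp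
    have ex: "exp ((1 - c) * Ln u) = u * exp (- c * Ln u)"
      using nz by (simp add: algebra_simps exp_diff exp_minus divide_inverse)
    have "((\<lambda>u. exp ((1 - c) * Ln u) * \<Psi> u - l * Ln u) has_field_derivative
       exp ((1 - c) * Ln u) * ((1 - c) * inverse u) * \<Psi> u + eval_fps (fps_deriv Q) u * exp ((1 - c) * Ln u) - l * inverse u) (at u)"
      using u by (auto intro!: derivative_eq_intros d\<Psi>)
    also have "exp ((1 - c) * Ln u) * ((1 - c) * inverse u) * \<Psi> u + eval_fps (fps_deriv Q) u * exp ((1 - c) * Ln u) - l * inverse u
      = - (exp (- c * Ln u) * ((c - 1) * \<Psi> u - u * eval_fps (fps_deriv Q) u)) - l / u"
      unfolding ex using nz by (simp add: field_simps)
    also have "\<dots> = - (exp (- c * Ln u) * (\<phi> u - l * u ^ m)) - l / u"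
      using ode[of u] u by simp
    also have "\<dots> = - (exp (- c * Ln u) * \<phi> u)"
      using lm[OF nz] by (simp add: algebra_simps)
    finally show "((\<lambda>u. exp ((1 - c) * Ln u) * \<Psi> u - l * Ln u) has_field_derivative
       - (exp (- c * Ln u) * \<phi> u)) (at u)" .
  qed
qed

text \<open>The quotient F(1 - u)/F(u) has the Wronskian divided by F(u)^2 as derivative, which is
  integrated on a slit ball small enough for \<open>F\<close> to have no zero. \<open>C\<close> is
  the constant of integration.\<close>

lemma hyp2f1_near_one:
  fixes d :: nat
  defines "c \<equiv> of_nat d / 2"
  assumes "d \<ge> 2" and ab: "a + b + 1 = 2 * c"
  defines "F \<equiv> hyp2f1 a b c"
  obtains r C \<kappa> \<Psi> l where "0 < r" "r \<le> 1" "\<Psi> holomorphic_on ball 0 r" "c \<noteq> 1 \<Longrightarrow> \<Psi> 0 \<noteq> 0" "odd d \<Longrightarrow> l = 0"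
    "\<And>u. u \<in> ball 0 r \<Longrightarrow> F u \<noteq> 0"
    "\<And>u. u \<in> ball 0 r - \<real>\<^sub>\<le>\<^sub>0 \<Longrightarrow> F (1 - u) = F u * (C - \<kappa> * (exp ((1 - c) * Ln u) * \<Psi> u - l * Ln u))"
proof -
  have c: "c \<notin> \<int>\<^sub>\<le>\<^sub>0"
    using assms(2) by (auto simp: c_def nonpos_Ints_def complex_eq_iff)
  note F = hyp2f1_properties[OF ab c, folded F_def]
  note op = open_cut_plane
  have "isCont F 0"
    using F(1) open_cut_plane zero_in_cut_plane holomorphic_on_imp_continuous_on continuous_on_eq_continuous_at by blast
  then have "(F \<longlongrightarrow> F 0) (nhds 0)"
    by (simp only: isCont_def tendsto_at_iff_tendsto_nhds)
  then have "eventually (\<lambda>u. F u \<noteq> 0) (nhds 0)"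
    by (rule tendsto_imp_eventually_ne) (simp add: F(4))
  then obtain r0 where r0: "r0 > 0" "\<And>u. dist u 0 < r0 \<Longrightarrow> F u \<noteq> 0"
    by (auto simp: eventually_nhds_metric)
  define r where "r = min r0 1"
  have r: "0 < r" "r \<le> 1" "\<And>u. u \<in> ball 0 r \<Longrightarrow> F u \<noteq> 0"
    using r0 by (auto simp: r_def dist_commute)
  define S where "S = (ball 0 r - \<real>\<^sub>\<le>\<^sub>0 :: complex set)"
  have cp: "u \<in> cut_plane" if "u \<in> ball 0 r" for u
    using that r(2) unit_ball_subset_cut_plane by force
  have cp1: "1 - u \<in> cut_plane" if "u \<in> S" for u
    using that by (simp add: cut_plane_iff S_def)
  have S_ball: "u \<in> ball 0 r" if "u \<in> S" for u
    using that by (simp add: S_def)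
  have S_slit: "u \<notin> \<real>\<^sub>\<le>\<^sub>0" "1 - u \<notin> \<real>\<^sub>\<le>\<^sub>0" "u \<noteq> 0" "1 - u \<noteq> 0" if "u \<in> S" for u
    using that cp[OF S_ball[OF that]] by (auto simp: cut_plane_iff S_def)
  define F1 where "F1 = deriv F"
  define F2 where "F2 = deriv F1"
  have dF: "(F has_field_derivative F1 z) (at z)" if "z \<in> cut_plane" for z
    unfolding F1_def using holomorphic_derivI[OF F(1) op that] .
  have dF1: "(F1 has_field_derivative F2 z) (at z)" if "z \<in> cut_plane" for z
    unfolding F2_def using holomorphic_derivI[OF holomorphic_deriv[OF F(1) op] op that] by (simp add: F1_def)
  have ode: "z * (1 - z) * F2 z + (c - 2 * c * z) * F1 z - a * b * F z = 0" if "z \<in> cut_plane" for z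
    using F(3)[OF that] unfolding hyp_op_def ab by (simp add: F1_def F2_def)
  \<comment> \<open>The Wronskian of F(1 - u) and F(u); by Abel's identity its product
    \<open>V\<close> with (u(1 - u))^c is constant.\<close>
  define W where "W u = - F1 (1 - u) * F u - F (1 - u) * F1 u" for u
  define V where "V u = W u * exp (c * (Ln u + Ln (1 - u)))" for u
  have dFr: "((\<lambda>u. F (1 - u)) has_field_derivative - F1 (1 - u)) (at u)"
    "((\<lambda>u. F1 (1 - u)) has_field_derivative - F2 (1 - u)) (at u)" if "u \<in> S" for u
  proof -
    have "((\<lambda>u. 1 - u) has_field_derivative (-1)) (at u)"
      by (auto intro!: derivative_eq_intros)
    from DERIV_chain2[OF dF[OF cp1[OF that]] this] DERIV_chain2[OF dF1[OF cp1[OF that]] this]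
    show "((\<lambda>u. F (1 - u)) has_field_derivative - F1 (1 - u)) (at u)"
      "((\<lambda>u. F1 (1 - u)) has_field_derivative - F2 (1 - u)) (at u)" by simp_all
  qed
  have dV: "(V has_field_derivative 0) (at u)" if u: "u \<in> S" for u
  proof -
    have dW: "(W has_field_derivative (F2 (1 - u) * F u - F (1 - u) * F2 u)) (at u)"
      unfolding W_def[abs_def]
      by (auto intro!: derivative_eq_intros dF dF1 dFr cp S_ball u)
    have dE: "((\<lambda>u. exp (c * (Ln u + Ln (1 - u)))) has_field_derivative
        (exp (c * (Ln u + Ln (1 - u))) * (c * (inverse u - inverse (1 - u))))) (at u)"
      using S_slit[OF u] by (auto intro!: derivative_eq_intros)
    have "u * (1 - u) * (F2 (1 - u) * F u - F (1 - u) * F2 u) + c * (1 - 2 * u) * W u = 0"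
      using ode[OF cp[OF S_ball[OF u]]] ode[OF cp1[OF u]] unfolding W_def by algebra
    then have "(F2 (1 - u) * F u - F (1 - u) * F2 u) + W u * (c * (inverse u - inverse (1 - u))) = 0"
      using S_slit[OF u] by (simp add: divide_simps) (simp add: algebra_simps)
    then have "exp (c * (Ln u + Ln (1 - u))) * ((F2 (1 - u) * F u - F (1 - u) * F2 u) + W u * (c * (inverse u - inverse (1 - u)))) = 0"
      by simp
    then show ?thesis
      unfolding V_def[abs_def]
      by (intro DERIV_cong[OF DERIV_mult[OF dW dE]]) (simp add: algebra_simps)
  qed
  have S: "connected S" "open S"
    unfolding S_def using connected_slit_ball[OF r(1)] open_slit_ball by auto
  obtain \<kappa> where \<kappa>: "\<And>u. u \<in> S \<Longrightarrow> V u = \<kappa>"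
  proof (rule DERIV_zero_connected_constant[OF S, of "{}" V])
    show "continuous_on S V"
      using dV by (auto intro!: continuous_at_imp_continuous_on DERIV_isCont)
  qed (use dV in auto)
  \<comment> \<open>The derivative of the quotient is \<kappa> u^(-c) \<phi>(u), with \<phi> regular
    at 0.\<close>
  define \<phi> where "\<phi> u = exp (- c * Ln (1 - u)) / F u ^ 2" for u
  have \<phi>: "\<phi> holomorphic_on ball 0 r"
    unfolding \<phi>_def[abs_def]
    by (intro holomorphic_intros holomorphic_on_subset[OF F(1)]) (use r(3) cp in \<open>auto simp: cut_plane_iff\<close>)
  obtain \<Psi> l where \<Psi>: "\<Psi> holomorphic_on ball 0 r" "c \<noteq> 1 \<Longrightarrow> \<Psi> 0 = \<phi> 0 / (c - 1)" "odd d \<Longrightarrow> l = 0"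
    "\<And>u. u \<in> S \<Longrightarrow> ((\<lambda>u. exp ((1 - c) * Ln u) * \<Psi> u - l * Ln u) has_field_derivative
       - (exp (- c * Ln u) * \<phi> u)) (at u)"
    by (rule primitive_of_power_times_holomorphic[OF assms(2) \<phi> r(1), folded c_def S_def]) (rule that)
  define K where "K u = F (1 - u) / F u + \<kappa> * (exp ((1 - c) * Ln u) * \<Psi> u - l * Ln u)" for u
  have dK: "(K has_field_derivative 0) (at u)" if u: "u \<in> S" for u
  proof -
    have nz: "F u \<noteq> 0" using r(3) S_ball u by blast
    have W: "W u = \<kappa> * exp (- c * Ln u) * exp (- c * Ln (1 - u))"
      using \<kappa>[OF u] by (auto simp: V_def exp_add ring_distribs exp_minus field_simps)
    have "((\<lambda>u. F (1 - u) / F u) has_field_derivative (W u / F u ^ 2)) (at u)"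
      using nz by (auto intro!: derivative_eq_intros dF dFr cp S_ball u simp: W_def power2_eq_square)
    from DERIV_add[OF this DERIV_cmult[OF \<Psi>(4)[OF u], of \<kappa>]] show ?thesis
      unfolding K_def[abs_def] W by (simp add: \<phi>_def)
  qed
  obtain C where C: "\<And>u. u \<in> S \<Longrightarrow> K u = C"
  proof (rule DERIV_zero_connected_constant[OF S, of "{}" K])
    show "continuous_on S K"
      using dK by (auto intro!: continuous_at_imp_continuous_on DERIV_isCont)
  qed (use dK in auto)
  show thesis
  proof (rule that[OF r(1,2) \<Psi>(1)])
    show "\<Psi> 0 \<noteq> 0" if "c \<noteq> 1"
      using \<Psi>(2)[OF that] that F(4) by (simp add: \<phi>_def)
    show "F (1 - u) = F u * (C - \<kappa> * (exp ((1 - c) * Ln u) * \<Psi> u - l * Ln u))" if u: "u \<in> ball 0 r - \<real>\<^sub>\<le>\<^sub>0" for u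
    proof -
      have "F u \<noteq> 0" "F (1 - u) / F u + \<kappa> * (exp ((1 - c) * Ln u) * \<Psi> u - l * Ln u) = C"
        using u r(3) C[of u] by (auto simp: S_def K_def)
      then show ?thesis by (simp add: field_simps)
    qed
  qed (use r(3) \<Psi>(3) in auto)
qed

text \<open>Near the slit write u = -v with v tending to x > 0. There Ln(-v) = Ln v - i \<sigma> pi,
  and Ln is continuous at x. Treating the logarithm as a second argument of \<open>H\<close> thus
  yields both one-sided limits at once.\<close>

lemma boundary_value_tendsto:
  fixes r x \<sigma> :: real
  assumes "\<And>u. u \<in> ball 0 r - \<real>\<^sub>\<le>\<^sub>0 \<Longrightarrow> F (1 - u) = H u (Ln u)"
    and "0 < x" "x < r" "\<sigma> = 1 \<or> \<sigma> = -1"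
    and cont: "isCont (\<lambda>(u, L). H u L) (- of_real x, of_real (ln x) - \<i> * of_real (\<sigma> * pi))"
  shows "((\<lambda>e. F (of_real (1 + x) + of_real \<sigma> * (\<i> * of_real e))) \<longlongrightarrow> H (- of_real x) (of_real (ln x) - \<i> * of_real (\<sigma> * pi))) (at_right 0)"
proof -
  define v where "v e = of_real x + of_real \<sigma> * (\<i> * of_real e)" for e :: real
  have v: "(v \<longlongrightarrow> v 0) (at_right 0)"
    unfolding v_def by (intro tendsto_intros)
  have v0: "v 0 = of_real x" by (simp add: v_def)
  have lim_Ln: "((\<lambda>e. Ln (v e) - \<i> * of_real (\<sigma> * pi)) \<longlongrightarrow> of_real (ln x) - \<i> * of_real (\<sigma> * pi)) (at_right 0)"
  proof -
    have "((\<lambda>e. Ln (v e)) \<longlongrightarrow> Ln (v 0)) (at_right 0)"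
      by (intro tendsto_Ln v) (use assms(2) in \<open>auto simp: v0\<close>)
    then show ?thesis
      using assms(2) by (intro tendsto_intros) (simp add: v0 Ln_of_real)
  qed
  have lim: "((\<lambda>e. (- v e, Ln (v e) - \<i> * of_real (\<sigma> * pi))) \<longlongrightarrow> (- of_real x, of_real (ln x) - \<i> * of_real (\<sigma> * pi))) (at_right 0)"
    using v v0 by (intro tendsto_intros lim_Ln) simp
  have "((\<lambda>e. H (- v e) (Ln (v e) - \<i> * of_real (\<sigma> * pi))) \<longlongrightarrow> H (- of_real x) (of_real (ln x) - \<i> * of_real (\<sigma> * pi))) (at_right 0)"
    using isCont_tendsto_compose[OF cont lim] by simp
  moreover have "eventually (\<lambda>e. H (- v e) (Ln (v e) - \<i> * of_real (\<sigma> * pi)) = F (of_real (1 + x) + of_real \<sigma> * (\<i> * of_real e))) (at_right 0)"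
  proof -
    have "((\<lambda>e. norm (v e)) \<longlongrightarrow> norm (v 0)) (at_right 0)"
      by (intro tendsto_intros v)
    then have "eventually (\<lambda>e. norm (v e) < r) (at_right 0)"
      by (rule order_tendstoD) (use assms(2,3) in \<open>simp add: v0\<close>)
    moreover have "eventually (\<lambda>e::real. e > 0) (at_right 0)"
      by (rule eventually_at_right_less)
    ultimately show ?thesis
    proof eventually_elim
      case (elim e)
      have Im: "Im (v e) = \<sigma> * e" by (simp add: v_def)
      have "- v e \<in> ball 0 r - \<real>\<^sub>\<le>\<^sub>0"
        using elim assms(4) by (auto simp: complex_nonpos_Reals_iff Im)
      from assms(1)[OF this] have "F (1 + v e) = H (- v e) (Ln (- v e))" by simp
      moreover have "Ln (- v e) = Ln (v e) - \<i> * of_real (\<sigma> * pi)"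
        using elim assms(4) Im Ln_minus[of "v e"] by (cases "v e = 0") auto
      moreover have "of_real (1 + x) + of_real \<sigma> * (\<i> * of_real e) = 1 + v e"
        by (simp add: v_def)
      ultimately show ?case by (simp only:)
    qed
  qed
  ultimately show ?thesis
    by (rule Lim_transform_eventually)
qed

text \<open>Gluing \<open>h\<close> and \<open>N\<close> gives a holomorphic function on the disc of
  radius 1 + r about 0, since the points of that disc on the cut lie in [1, 1 + r).\<close>

lemma fps_conv_radius_gt_1_if_extends:
  assumes "h holomorphic_on cut_plane" "h has_fps_expansion Y" "r > 0"
    and "N holomorphic_on ball 1 r" "\<And>z. z \<in> ball 1 r \<Longrightarrow> z \<in> cut_plane \<Longrightarrow> h z = N z"
  shows "fps_conv_radius Y > 1"
proof -
  define k where "k z = (if z \<in> cut_plane then h z else N z)" for z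
  have k1: "k holomorphic_on cut_plane"
    using assms(1) by (rule holomorphic_transform) (simp add: k_def)
  have k2: "k holomorphic_on ball 1 r"
    using assms(4) by (rule holomorphic_transform) (simp add: k_def assms(5))
  have "k holomorphic_on (cut_plane \<union> ball 1 r)"
    by (rule holomorphic_on_Un[OF k1 k2 open_cut_plane open_ball])
  moreover have "ball 0 (1 + r) \<subseteq> cut_plane \<union> ball 1 r"
  proof
    fix z :: complex assume z: "z \<in> ball 0 (1 + r)"
    have "z \<in> ball 1 r" if "z \<notin> cut_plane"
    proof -
      have 1: "1 - z = of_real (1 - Re z)" "1 \<le> Re z"
        using that by (auto simp: cut_plane_def complex_eq_iff)
      moreover have "Re z < 1 + r" using z abs_Re_le_cmod[of z] by simp
      ultimately show ?thesis unfolding mem_ball dist_norm 1(1) norm_of_real by simp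
    qed
    then show "z \<in> cut_plane \<union> ball 1 r" by blast
  qed
  ultimately have "k holomorphic_on eball 0 (ereal (1 + r))"
    by (auto intro: holomorphic_on_subset)
  moreover have "k has_fps_expansion Y"
  proof -
    have "eventually (\<lambda>z. k z = h z) (nhds 0)"
      using eventually_nhds_in_open[OF open_cut_plane zero_in_cut_plane]
      by eventually_elim (simp add: k_def)
    from has_fps_expansion_cong[OF this refl, of Y] show ?thesis using assms(2) by simp
  qed
  ultimately have "ereal (1 + r) \<le> fps_conv_radius Y"
    by (intro holomorphic_on_imp_fps_conv_radius_ge)
  moreover have "1 < ereal (1 + r)" using assms(3) by (simp add: one_ereal_def)
  ultimately show ?thesis by (rule less_le_trans[rotated])
qed

subsection \<open>The jump across the cut\<close>

lemma no_jump_imp_parameters: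
  fixes d :: nat
  defines "c \<equiv> of_nat d / 2"
  assumes "d \<ge> 2" and ab: "a + b + 1 = 2 * c" and a: "a \<notin> \<int>\<^sub>\<le>\<^sub>0" and b: "b \<notin> \<int>\<^sub>\<le>\<^sub>0"
    and no_jump: "\<And>s. s > 1 \<Longrightarrow> bv_minus (hyp2f1 a b c) s = bv_plus (hyp2f1 a b c) s"
  shows "even d \<and> (c - a \<in> \<int>\<^sub>\<le>\<^sub>0 \<or> c - b \<in> \<int>\<^sub>\<le>\<^sub>0)"
proof -
  define F where "F = hyp2f1 a b c"
  have c: "c \<notin> \<int>\<^sub>\<le>\<^sub>0"
    using assms(2) by (auto simp: c_def nonpos_Ints_def complex_eq_iff)
  note F = hyp2f1_properties[OF ab c, folded F_def]
  obtain r C \<kappa> \<Psi> l where r: "0 < r" "r \<le> 1" and \<Psi>: "\<Psi> holomorphic_on ball 0 r" "c \<noteq> 1 \<Longrightarrow> \<Psi> 0 \<noteq> 0"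
    and l: "odd d \<Longrightarrow> l = 0" and F_nz: "\<And>u. u \<in> ball 0 r \<Longrightarrow> F u \<noteq> 0"
    and F_eq: "\<And>u. u \<in> ball 0 r - \<real>\<^sub>\<le>\<^sub>0 \<Longrightarrow> F (1 - u) = F u * (C - \<kappa> * (exp ((1 - c) * Ln u) * \<Psi> u - l * Ln u))"
    by (rule hyp2f1_near_one[OF assms(2) ab[unfolded c_def], folded c_def F_def]) (rule that)
  have ball_cp: "ball 0 r \<subseteq> cut_plane"
    using unit_ball_subset_cut_plane r(2) by (meson order_trans subset_ball)
  have cont: "isCont F u" "isCont \<Psi> u" if "u \<in> ball 0 r" for u
    using that F(1) \<Psi>(1) ball_cp
    by (meson continuous_on_eq_continuous_at holomorphic_on_imp_continuous_on holomorphic_on_subset open_ball)+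
  \<comment> \<open>Crossing the cut multiplies the power by (-1)^d and changes the logarithm by 2
    pi i; the factor F(u) is nonzero and drops out.\<close>
  have jump: "\<kappa> * (exp ((1 - c) * (of_real (ln x) - \<i> * of_real pi)) * ((-1) ^ d - 1) * \<Psi> (- of_real x) - l * (2 * \<i> * of_real pi)) = 0"
    if x: "0 < x" "x < r" for x :: real
  proof -
    define H where "H u L = F u * (C - \<kappa> * (exp ((1 - c) * L) * \<Psi> u - l * L))" for u L
    have mem: "- of_real x \<in> ball (0::complex) r" using x by simp
    have "isCont (\<lambda>p. F (fst p)) (- of_real x, L)" "isCont (\<lambda>p. \<Psi> (fst p)) (- of_real x, L)" for L :: complex
      using cont[OF mem] by (auto intro: isCont_o2[OF isCont_fst[OF continuous_ident]])
    then have "isCont (\<lambda>p. F (fst p) * (C - \<kappa> * (exp ((1 - c) * snd p) * \<Psi> (fst p) - l * snd p))) (- of_real x, L)" for L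
      by (intro continuous_intros)
    then have "isCont (\<lambda>(u, L). H u L) (- of_real x, L)" for L
      by (simp add: H_def case_prod_unfold)
    then have lim: "((\<lambda>e. F (of_real (1 + x) + of_real \<sigma> * (\<i> * of_real e))) \<longlongrightarrow>
       H (- of_real x) (of_real (ln x) - \<i> * of_real (\<sigma> * pi))) (at_right 0)" if "\<sigma> = 1 \<or> \<sigma> = -1" for \<sigma> :: real
      using F_eq x that by (intro boundary_value_tendsto) (auto simp: H_def)
    have "bv_plus F (1 + x) = H (- of_real x) (of_real (ln x) - \<i> * of_real pi)"
      unfolding bv_plus_def using lim[of 1] by (intro tendsto_Lim) simp_all
    moreover have "bv_minus F (1 + x) = H (- of_real x) (of_real (ln x) + \<i> * of_real pi)"
      unfolding bv_minus_def using lim[of "-1"] by (intro tendsto_Lim) simp_all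
    ultimately have eq: "H (- of_real x) (of_real (ln x) + \<i> * of_real pi) = H (- of_real x) (of_real (ln x) - \<i> * of_real pi)"
      using no_jump[of "1 + x"] x by (simp add: F_def)
    have "exp ((1 - c) * (of_real (ln x) + \<i> * of_real pi)) = 
        exp ((1 - c) * (of_real (ln x) - \<i> * of_real pi) + (2 * of_real pi * \<i> + of_nat d * (- (of_real pi * \<i>))))"
      by (rule arg_cong[where f = exp]) (simp add: c_def field_simps)
    also have "\<dots> = exp ((1 - c) * (of_real (ln x) - \<i> * of_real pi)) * (exp (2 * of_real pi * \<i>) * exp (- (of_real pi * \<i>)) ^ d)"
      by (simp only: exp_add exp_of_nat_mult)
    also have "\<dots> = exp ((1 - c) * (of_real (ln x) - \<i> * of_real pi)) * (-1) ^ d"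
      by (simp add: exp_minus)
    finally have exps: "exp ((1 - c) * (of_real (ln x) + \<i> * of_real pi)) = exp ((1 - c) * (of_real (ln x) - \<i> * of_real pi)) * (-1) ^ d" .
    have "v = w" if "t \<noteq> 0" "t * (C - v) = t * (C - w)" for t v w :: complex
      using that by simp
    from this[OF F_nz[OF mem] eq[unfolded H_def exps]] show ?thesis
      by (simp add: algebra_simps)
  qed
  have \<kappa>l: "\<kappa> * l = 0"
  proof (cases "even d")
    case True
    then show ?thesis using jump[of "r / 2"] r by simp
  qed (simp add: l)
  \<comment> \<open>Here (-1)^d - 1 = -2 and the logarithm is absent, so a point near 0 with \<Psi>
    nonzero suffices.\<close>
  have \<kappa>: "\<kappa> = 0" if "odd d"
  proof -
    have "c \<noteq> 1"
    proof
      assume "c = 1"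
      then have "of_nat d = (of_nat 2 :: complex)" by (simp add: c_def)
      then have "d = 2" by (simp only: of_nat_eq_iff)
      with that show False by simp
    qed
    then have "\<Psi> 0 \<noteq> 0" by (rule \<Psi>(2))
    moreover have "(\<Psi> \<longlongrightarrow> \<Psi> 0) (nhds 0)"
      using cont(2)[of 0] r by (simp only: isCont_def tendsto_at_iff_tendsto_nhds) simp
    ultimately have "eventually (\<lambda>u. \<Psi> u \<noteq> 0) (nhds 0)"
      by (intro tendsto_imp_eventually_ne)
    then obtain e where e: "e > 0" "\<And>u. dist u 0 < e \<Longrightarrow> \<Psi> u \<noteq> 0"
      by (auto simp: eventually_nhds_metric)
    define x where "x = min e r / 2"
    have x: "0 < x" "x < r" "x < e" using e(1) r(1) by (auto simp: x_def)
    have "\<Psi> (- of_real x) \<noteq> 0" using x by (intro e(2)) simp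
    then show ?thesis using jump[OF x(1,2)] that l[OF that] by simp
  qed
  have near: "u \<in> ball 0 r - \<real>\<^sub>\<le>\<^sub>0" if "z \<in> ball 1 r" "z \<in> cut_plane" "u = 1 - z" for z u
    using that by (auto simp: cut_plane_iff dist_norm norm_minus_commute)
  have hol1: "(\<lambda>z. g (1 - z)) holomorphic_on ball 1 r" if "g holomorphic_on ball 0 r" for g
  proof -
    have "(g \<circ> (\<lambda>z. 1 - z)) holomorphic_on ball 1 r"
      by (rule holomorphic_on_compose_gen[OF _ that])
        (auto intro!: holomorphic_intros simp: dist_norm norm_minus_commute)
    then show ?thesis by (simp add: o_def)
  qed
  have "even d"
  proof (rule ccontr)
    assume odd: "odd d"
    \<comment> \<open>With \<kappa> = 0 the function near 1 is C F(1 - z), which is regular at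
      1.\<close>
    have "fps_conv_radius (fps_hyp a b c) > 1"
    proof (rule fps_conv_radius_gt_1_if_extends[OF F(1,2) r(1)])
      show "(\<lambda>z. C * F (1 - z)) holomorphic_on ball 1 r"
        by (intro holomorphic_intros hol1 holomorphic_on_subset[OF F(1) ball_cp])
      show "F z = C * F (1 - z)" if "z \<in> ball 1 r" "z \<in> cut_plane" for z
        using F_eq[OF near[OF that refl]] \<kappa>[OF odd] by simp
    qed
    then show False using fps_conv_radius_hyp[OF a b c] by simp
  qed
  moreover have "c - a \<in> \<int>\<^sub>\<le>\<^sub>0 \<or> c - b \<in> \<int>\<^sub>\<le>\<^sub>0"
  proof (rule ccontr)
    assume "\<not> ?thesis"
    then have radius: "fps_conv_radius (fps_hyp (c - a) (c - b) c) = 1"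
      using c by (intro fps_conv_radius_hyp) auto
    obtain n where "d = 2 * n" using \<open>even d\<close> by blast
    then obtain m where m: "d = 2 * Suc m" using assms(2) by (cases n) auto
    have cm: "c = of_nat m + 1" by (simp add: c_def m field_simps)
    \<comment> \<open>The factor (1 - z)^m with m = c - 1 cancels the pole, and
      \<open>\<kappa>l\<close> removes the logarithm.\<close>
    have "fps_conv_radius (fps_hyp (c - a) (c - b) c) > 1"
    proof (rule fps_conv_radius_gt_1_if_extends)
      show "(\<lambda>z. (1 - z) ^ m * F z) holomorphic_on cut_plane"
        by (intro holomorphic_intros F(1))
      have "a + b - c = of_nat m" using ab cm by (simp add: algebra_simps)
      from fps_hyp_euler[OF c this, symmetric]
      show "(\<lambda>z. (1 - z) ^ m * F z) has_fps_expansion fps_hyp (c - a) (c - b) c"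
        by (simp only:) (intro fps_expansion_intros F(2))
      show "(\<lambda>z. F (1 - z) * (C * (1 - z) ^ m - \<kappa> * \<Psi> (1 - z))) holomorphic_on ball 1 r"
        by (intro holomorphic_intros hol1 holomorphic_on_subset[OF F(1) ball_cp] \<Psi>(1))
      show "(1 - z) ^ m * F z = F (1 - z) * (C * (1 - z) ^ m - \<kappa> * \<Psi> (1 - z))" if z: "z \<in> ball 1 r" "z \<in> cut_plane" for z
      proof -
        define u where "u = 1 - z"
        have u: "u \<in> ball 0 r - \<real>\<^sub>\<le>\<^sub>0" using near[OF z u_def] .
        then have nz: "u \<noteq> 0" by auto
        have "exp ((1 - c) * Ln u) = inverse (exp (of_nat m * Ln u))"
          by (simp add: cm exp_minus)
        also have "exp (of_nat m * Ln u) = u ^ m"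
          by (simp only: exp_of_nat_mult exp_Ln[OF nz])
        finally have e: "u ^ m * exp ((1 - c) * Ln u) = 1" using nz by simp
        have Fz: "F z = F u * (C - \<kappa> * (exp ((1 - c) * Ln u) * \<Psi> u - l * Ln u))"
          using F_eq[OF u] by (simp add: u_def)
        have "u ^ m * F z = F u * (C * u ^ m - \<kappa> * (u ^ m * exp ((1 - c) * Ln u)) * \<Psi> u + \<kappa> * l * Ln u * u ^ m)"
          unfolding Fz by (simp add: algebra_simps)
        also have "\<dots> = F u * (C * u ^ m - \<kappa> * \<Psi> u)"
          unfolding e \<kappa>l by simp
        finally show ?thesis by (simp add: u_def)
      qed
    qed (rule r)
    with radius show False by simp
  qed
  ultimately show ?thesis by blast
qed

section \<open>The converse: rational hypergeometric functions\<close>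

lemma has_fps_expansion_polynomial:
  fixes P :: "complex fps"
  assumes "\<And>n. n > k \<Longrightarrow> fps_nth P n = 0"
  shows "(\<lambda>z. \<Sum>n\<le>k. fps_nth P n * z ^ n) has_fps_expansion P"
  by (intro has_fps_expansionI always_eventually allI sums_finite) (use assms in auto)

text \<open>The Euler-transformed series stops at degree \<open>k\<close>, so \<open>hyp2f1\<close>
  is a polynomial divided by (1 - z)^m. This is continuous at s > 1, and both boundary values equal
  its value there.\<close>

lemma no_jump_if_parameters:
  assumes c: "c \<notin> \<int>\<^sub>\<le>\<^sub>0" and abc: "a + b - c = of_nat m" and a: "c - a = - of_nat k" and "s > 1"
  shows "bv_minus (hyp2f1 a b c) s = bv_plus (hyp2f1 a b c) s"
proof -
  define P where "P = fps_hyp (c - a) (c - b) c"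
  define p where "p z = (\<Sum>n\<le>k. fps_nth P n * z ^ n)" for z
  define f where "f z = p z * inverse ((1 - z) ^ m)" for z
  have "fps_nth P n = 0" if "n > k" for n
    using that by (simp add: P_def fps_hyp_def a pochhammer_of_nat_eq_0_iff)
  then have p: "p has_fps_expansion P"
    unfolding p_def[abs_def] by (rule has_fps_expansion_polynomial)
  define V :: "complex fps" where "V = (1 - fps_X) ^ m"
  have V0: "fps_nth V 0 \<noteq> 0"
    by (simp add: V_def fps_power_zeroth)
  have V: "(\<lambda>z. (1 - z) ^ m) has_fps_expansion V"
    unfolding V_def by (intro fps_expansion_intros)
  have VP: "V * fps_hyp a b c = P"
    unfolding V_def P_def by (rule fps_hyp_euler[OF c abc])
  have "P * inverse V = V * inverse V * fps_hyp a b c"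
    unfolding VP[symmetric] by (simp only: mult_ac)
  also have "\<dots> = fps_hyp a b c"
    using inverse_mult_eq_1'[OF V0] by simp
  finally have "P * inverse V = fps_hyp a b c" .
  then have exp: "f has_fps_expansion fps_hyp a b c"
    using has_fps_expansion_mult[OF p has_fps_expansion_inverse[OF V V0]] by (simp add: f_def[abs_def])
  have hol: "f holomorphic_on - {1}"
    unfolding f_def[abs_def] p_def by (intro holomorphic_intros) auto
  have "cut_plane \<subseteq> - {1}" by (auto simp: cut_plane_def)
  then have eq: "hyp2f1 a b c z = f z" if "z \<in> cut_plane" for z
    using hyp2f1_eqI[OF holomorphic_on_subset[OF hol] exp that] by simp
  have "isCont f (of_real s)"
    by (intro field_differentiable_imp_continuous_at holomorphic_on_imp_differentiable_at[OF hol])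
      (use \<open>s > 1\<close> in \<open>auto intro: open_Compl\<close>)
  then have lim: "((\<lambda>e. hyp2f1 a b c (of_real s + v * of_real e)) \<longlongrightarrow> f (of_real s)) (at_right 0)"
    if v: "v = \<i> \<or> v = - \<i>" for v
  proof -
    have "((\<lambda>e. of_real s + v * of_real e) \<longlongrightarrow> of_real s + v * of_real 0) (at_right (0::real))"
      by (intro tendsto_intros)
    then have "((\<lambda>e. f (of_real s + v * of_real e)) \<longlongrightarrow> f (of_real s)) (at_right (0::real))"
      using \<open>isCont f (of_real s)\<close> by (intro isCont_tendsto_compose[where g = f]) simp_all
    moreover have "eventually (\<lambda>e. f (of_real s + v * of_real e) = hyp2f1 a b c (of_real s + v * of_real e)) (at_right (0::real))"
      using eventually_at_right_less
    proof eventually_elim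
      case (elim e)
      then have "of_real s + v * of_real e \<in> cut_plane"
        using v by (auto simp: cut_plane_def)
      then show ?case by (simp add: eq)
    qed
    ultimately show ?thesis by (rule Lim_transform_eventually)
  qed
  have "bv_plus (hyp2f1 a b c) s = f (of_real s)"
    unfolding bv_plus_def using lim[of "\<i>"] by (intro tendsto_Lim) simp_all
  moreover have "bv_minus (hyp2f1 a b c) s = f (of_real s)"
    unfolding bv_minus_def using lim[of "- \<i>"] by (intro tendsto_Lim) simp_all
  ultimately show ?thesis by simp
qed

theorem mainTheorem19:
  fixes d :: nat and lam :: complex
  assumes "d \<ge> 2"
    and "(Re lam = 0 \<and> Im lam \<ge> 0) \<or> (Im lam = 0 \<and> 0 < Re lam \<and> Re lam < (real d - 1) / 2)"
  shows "(\<forall>s::real. s > 1 \<longrightarrow>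
            bv_minus (hyp2f1 ((of_nat d - 1) / 2 + lam) ((of_nat d - 1) / 2 - lam) (of_nat d / 2)) s
          - bv_plus (hyp2f1 ((of_nat d - 1) / 2 + lam) ((of_nat d - 1) / 2 - lam) (of_nat d / 2)) s = 0)
     \<longleftrightarrow> (even d \<and> d \<ge> 4 \<and>
          (\<exists>k::nat. real k \<le> real d / 2 - 2 \<and> lam = complex_of_real ((1 + 2 * real k) / 2)))"
proof -
  define a b c where "a = (of_nat d - 1) / 2 + lam" and "b = (of_nat d - 1) / 2 - lam"
    and "c = (of_nat d / 2 :: complex)"
  have ab: "a + b + 1 = 2 * c" by (simp add: a_def b_def c_def field_simps)
  have "real d \<ge> 2" using assms(1) by simp
  moreover have "Re a = (real d - 1) / 2 + Re lam" "Re b = (real d - 1) / 2 - Re lam" "Re c = real d / 2"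
    by (simp_all add: a_def b_def c_def)
  moreover have "0 \<le> Re lam" "Re lam = 0 \<or> Re lam < (real d - 1) / 2"
    using assms(2) by auto
  ultimately have Re: "Re a > 0" "Re b > 0" "Re c > 0"
    by (auto simp: field_simps)
  have pos: "z \<notin> \<int>\<^sub>\<le>\<^sub>0" if "Re z > 0" for z
    using that by (auto elim!: nonpos_Ints_cases)
  have "(\<forall>s>1. bv_minus (hyp2f1 a b c) s = bv_plus (hyp2f1 a b c) s) \<longleftrightarrow>
    (even d \<and> d \<ge> 4 \<and> (\<exists>k::nat. real k \<le> real d / 2 - 2 \<and> lam = complex_of_real ((1 + 2 * real k) / 2)))"
  proof
    assume "\<forall>s>1. bv_minus (hyp2f1 a b c) s = bv_plus (hyp2f1 a b c) s"
    then have "even d" "c - a \<in> \<int>\<^sub>\<le>\<^sub>0 \<or> c - b \<in> \<int>\<^sub>\<le>\<^sub>0"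
      using no_jump_imp_parameters[OF assms(1), of a b, folded c_def, OF ab pos pos] Re by blast+
    \<comment> \<open>Here c - b = 1/2 + \<lambda> has positive real part, so only c - a = 1/2 -
      \<lambda> remains.\<close>
    moreover have "c - b \<notin> \<int>\<^sub>\<le>\<^sub>0"
      using assms(2) by (intro pos) (auto simp: b_def c_def field_simps)
    ultimately have "c - a \<in> \<int>\<^sub>\<le>\<^sub>0" by blast
    then obtain k where k: "c - a = - of_nat k"
      by (auto elim: nonpos_Ints_cases')
    have "lam = 1 / 2 - (c - a)" by (simp add: a_def c_def field_simps)
    then have lam: "lam = complex_of_real ((1 + 2 * real k) / 2)"
      unfolding k by (simp add: add_divide_distrib)
    have "Re lam = (1 + 2 * real k) / 2"
      unfolding lam by (rule Re_complex_of_real)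
    then have "(1 + 2 * real k) / 2 < (real d - 1) / 2"
      using assms(2) by auto
    then have "real (2 * k + 2) < real d" by simp
    then have "2 * k + 2 < d" by (simp only: of_nat_less_iff)
    \<comment> \<open>Parity of \<open>d\<close> sharpens 2k + 2 < d to k + 2 \<le> d/2, which gives
      both bounds.\<close>
    moreover obtain n where "d = 2 * n" using \<open>even d\<close> by blast
    ultimately have n: "k + 2 \<le> n" "d = 2 * n" by auto
    then have "real (k + 2) \<le> real n" by (simp only: of_nat_le_iff)
    with n have "4 \<le> d" "real k \<le> real d / 2 - 2" by auto
    with lam \<open>even d\<close> show "even d \<and> d \<ge> 4 \<and> (\<exists>k::nat. real k \<le> real d / 2 - 2 \<and> lam = complex_of_real ((1 + 2 * real k) / 2))"
      by blast
  next
    assume "even d \<and> d \<ge> 4 \<and> (\<exists>k::nat. real k \<le> real d / 2 - 2 \<and> lam = complex_of_real ((1 + 2 * real k) / 2))"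
    then obtain k n where d: "d = 2 * n" "d \<ge> 4" and lam: "lam = complex_of_real ((1 + 2 * real k) / 2)"
      by blast
    obtain m where m: "n = Suc m" using d by (cases n) auto
    have "a + b - c = of_nat m" "c - a = - of_nat k"
      by (simp_all add: a_def b_def c_def d(1) m lam field_simps)
    then show "\<forall>s>1. bv_minus (hyp2f1 a b c) s = bv_plus (hyp2f1 a b c) s"
      using no_jump_if_parameters[OF pos[OF Re(3)]] by blast
  qed
  then show ?thesis by (simp add: a_def b_def c_def)
qed

end
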